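(* Let $\alpha$ be a real algebraic number of degree $d \geq 3$ over $\mathbb{Q}$ and let $\beta \in \mathbb{Q}(\alpha)$ be irrational. Let $\mu$ be a real number such that $(d/2) + 1 < \mu < d$ and let $C_0$ be a positive real number. There exist computable positive real numbers $C_1$ and $C_2$, which depend only on $\alpha$, $\beta$, $\mu$ and $C_0$, with the following property. If $x_1/y_1$ and $x_2/y_2$ are rational numbers in lowest terms such that $H(x_2, y_2) \geq H(x_1, y_1) \geq C_1$ and $$ \left|\alpha - \frac{x_1}{y_1}\right| < \frac{C_0}{H(x_1, y_1)^\mu}, \quad \left|\beta - \frac{x_2}{y_2}\right| < \frac{C_0}{H(x_2, y_2)^\mu}, $$ then at least one of the following holds: (i) $H(x_2, y_2) > C_2^{-1} H(x_1, y_1)^{\mu - d/2}$; (ii) there exist integers $s, t, u, v$, with $sv - tu \neq 0$, such that $$ \beta = \frac{s\alpha + t}{u\alpha + v} \quad \text{and} \quad \frac{x_2}{y_2} = \frac{sx_1 + ty_1}{ux_1 + vy_1}. $$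
   Context: For a rational number $x/y$ in lowest terms ($x, y$ coprime integers, $y \neq 0$), $H(x, y) = \max(|x|, |y|)$ denotes its height. *)

theory Defs
  imports
    Complex_Main
    "HOL-Library.Nat_Bijection"
    "HOL-Computational_Algebra.Polynomial"
begin

section \<open>Heights, degrees and number fields\<close>

definition height :: "int \<Rightarrow> int \<Rightarrow> int" where
  "height x y = max \<bar>x\<bar> \<bar>y\<bar>"

definition rpoly :: "rat poly \<Rightarrow> real \<Rightarrow> real" where
  "rpoly p x = poly (map_poly of_rat p) x"

text \<open>Monic minimal polynomial over the rationals; meaningful only for algebraic arguments.\<close>

definition min_poly :: "real \<Rightarrow> rat poly" where
  "min_poly \<alpha> = (THE p. lead_coeff p = 1 \<and> irreducible p \<and> rpoly p \<alpha> = 0)"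

definition algebraic_of_degree :: "real \<Rightarrow> nat \<Rightarrow> bool" where
  "algebraic_of_degree \<alpha> d \<longleftrightarrow> algebraic \<alpha> \<and> degree (min_poly \<alpha>) = d"

definition real_subfield :: "real set \<Rightarrow> bool" where
  "real_subfield K \<longleftrightarrow> 0 \<in> K \<and> 1 \<in> K \<and>
     (\<forall>x\<in>K. \<forall>y\<in>K. x + y \<in> K \<and> x * y \<in> K) \<and>
     (\<forall>x\<in>K. - x \<in> K \<and> inverse x \<in> K)"

definition rat_adjoin :: "real \<Rightarrow> real set" where
  "rat_adjoin \<alpha> = \<Inter>{K. real_subfield K \<and> \<alpha> \<in> K}"


section \<open>Partial recursive functionals\<close>

text \<open>
  The usual inductive characterisation of the partial recursive functions of one variable
  (tuples being coded by \<^const>\<open>prod_encode\<close>), relativised to a family of oracles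
  \<open>\<phi> 0, \<phi> 1, \<dots>\<close>. The functional is built uniformly in \<open>\<phi>\<close>, so it corresponds to one
  oracle program. \<^const>\<open>None\<close> stands for divergence.
\<close>

primrec prim_iter :: "(nat \<Rightarrow> nat option) \<Rightarrow> (nat \<Rightarrow> nat option) \<Rightarrow> nat \<Rightarrow> nat \<Rightarrow> nat option" where
  "prim_iter f g a 0 = f a"
| "prim_iter f g a (Suc m) =
     Option.bind (prim_iter f g a m) (\<lambda>r. g (prod_encode (a, prod_encode (m, r))))"

definition minimise :: "(nat \<Rightarrow> nat option) \<Rightarrow> nat \<Rightarrow> nat option" where
  "minimise f a =
     (if \<exists>m. f (prod_encode (a, m)) = Some 0 \<and> (\<forall>j<m. f (prod_encode (a, j)) \<noteq> None)
      then Some (LEAST m. f (prod_encode (a, m)) = Some 0) else None)"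

inductive recursive_functional :: "((nat \<Rightarrow> nat \<Rightarrow> nat) \<Rightarrow> nat \<Rightarrow> nat option) \<Rightarrow> bool" where
  zero: "recursive_functional (\<lambda>\<phi> n. Some 0)"
| succ: "recursive_functional (\<lambda>\<phi> n. Some (Suc n))"
| left: "recursive_functional (\<lambda>\<phi> n. Some (fst (prod_decode n)))"
| right: "recursive_functional (\<lambda>\<phi> n. Some (snd (prod_decode n)))"
| query: "recursive_functional (\<lambda>\<phi> n. Some (\<phi> i n))"
| pair: "recursive_functional F \<Longrightarrow> recursive_functional G \<Longrightarrow>
    recursive_functional
      (\<lambda>\<phi> n. Option.bind (F \<phi> n) (\<lambda>a. Option.bind (G \<phi> n) (\<lambda>b. Some (prod_encode (a, b)))))"
| comp: "recursive_functional F \<Longrightarrow> recursive_functional G \<Longrightarrow>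
    recursive_functional (\<lambda>\<phi> n. Option.bind (G \<phi> n) (F \<phi>))"
| prec: "recursive_functional F \<Longrightarrow> recursive_functional G \<Longrightarrow>
    recursive_functional
      (\<lambda>\<phi> n. prim_iter (F \<phi>) (G \<phi>) (fst (prod_decode n)) (snd (prod_decode n)))"
| mu: "recursive_functional F \<Longrightarrow> recursive_functional (\<lambda>\<phi> n. minimise (F \<phi>) n)"


section \<open>Constants computable in terms of the given data\<close>

text \<open>
  A real number is presented to, and produced by, an algorithm through dyadic approximations:
  the \<open>n\<close>-th value codes an integer \<open>k\<close> with \<open>\<bar>x - k / 2^n\<bar> \<le> 2^(-n)\<close>.
\<close>

definition approximates :: "nat \<Rightarrow> nat \<Rightarrow> real \<Rightarrow> bool" where
  "approximates c n x \<longleftrightarrow> \<bar>x - real_of_int (int_decode c) / 2 ^ n\<bar> \<le> 1 / 2 ^ n"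

definition real_name :: "(nat \<Rightarrow> nat) \<Rightarrow> real \<Rightarrow> bool" where
  "real_name f x \<longleftrightarrow> (\<forall>n. approximates (f n) n x)"

definition encode_rat :: "rat \<Rightarrow> nat" where
  "encode_rat r = (case quotient_of r of (a, b) \<Rightarrow> prod_encode (int_encode a, nat b))"

definition encode_rat_poly :: "rat poly \<Rightarrow> nat" where
  "encode_rat_poly p = list_encode (map encode_rat (coeffs p))"

text \<open>
  The number \<open>\<alpha>\<close> is given by its minimal polynomial together with approximations (which single
  it out among its conjugates), \<open>\<beta>\<close> by its coordinates with respect to the powers
  \<open>1, \<alpha>, \<dots>, \<alpha>^(d-1)\<close>, and the arbitrary reals \<open>\<mu>\<close> and \<open>C\<^sub>0\<close> by approximations.
\<close>

definition data_name ::
    "(nat \<Rightarrow> nat \<Rightarrow> nat) \<Rightarrow> real \<Rightarrow> real \<Rightarrow> real \<Rightarrow> real \<Rightarrow> bool" where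
  "data_name \<phi> \<alpha> \<beta> \<mu> C\<^sub>0 \<longleftrightarrow>
     (\<forall>n. \<phi> 0 n = encode_rat_poly (min_poly \<alpha>)) \<and>
     real_name (\<phi> 1) \<alpha> \<and>
     (\<exists>q. degree q < degree (min_poly \<alpha>) \<and> rpoly q \<alpha> = \<beta> \<and> (\<forall>n. \<phi> 2 n = encode_rat_poly q)) \<and>
     real_name (\<phi> 3) \<mu> \<and>
     real_name (\<phi> 4) C\<^sub>0"

definition admissible :: "nat \<Rightarrow> real \<Rightarrow> real \<Rightarrow> real \<Rightarrow> real \<Rightarrow> bool" where
  "admissible d \<alpha> \<beta> \<mu> C\<^sub>0 \<longleftrightarrow>
     algebraic_of_degree \<alpha> d \<and> 3 \<le> d \<and> \<beta> \<in> rat_adjoin \<alpha> \<and> \<beta> \<notin> \<rat> \<and>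
     real d / 2 + 1 < \<mu> \<and> \<mu> < real d \<and> 0 < C\<^sub>0"

text \<open>
  A constant that is computable in terms of \<open>\<alpha>, \<beta>, \<mu>, C\<^sub>0\<close>: one algorithm works for all
  admissible data, and its output describes a real number that is a function of the data
  themselves and not of the way they are presented.
\<close>

definition effectively_computable :: "(real \<Rightarrow> real \<Rightarrow> real \<Rightarrow> real \<Rightarrow> real) \<Rightarrow> bool" where
  "effectively_computable C \<longleftrightarrow>
     (\<exists>F. recursive_functional F \<and>
        (\<forall>d \<alpha> \<beta> \<mu> C\<^sub>0 \<phi>. admissible d \<alpha> \<beta> \<mu> C\<^sub>0 \<longrightarrow> data_name \<phi> \<alpha> \<beta> \<mu> C\<^sub>0 \<longrightarrow>
           (\<forall>n. \<exists>c. F \<phi> n = Some c \<and> approximates c n (C \<alpha> \<beta> \<mu> C\<^sub>0))))"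

end

theory Submission
  imports Defs
begin

text \<open>
  Let \<open>e \<le> d / 2\<close> be the least degree of integer polynomials \<open>P\<close>, \<open>Q\<close>, not both zero, with
  \<open>P(\<alpha>) = \<beta> Q(\<alpha>)\<close>; counting unknowns and equations shows that \<open>e\<close> exists. Write
  \<open>\<xi> = x\<^sub>1 / y\<^sub>1\<close> and \<open>\<eta> = x\<^sub>2 / y\<^sub>2\<close>. If \<open>P(\<xi>) \<noteq> \<eta> Q(\<xi>)\<close>, then this difference is at least
  \<open>1 / \<bar>y\<^sub>1\<^sup>e y\<^sub>2\<bar>\<close> and at most a constant times \<open>C\<^sub>0 H(x\<^sub>1, y\<^sub>1) powr (- \<mu>)\<close>, which gives (i).
  Otherwise \<open>\<eta> = P(\<xi>) / Q(\<xi>)\<close>. By minimality of \<open>e\<close> the polynomials \<open>P\<close>, \<open>Q\<close> are coprime, so the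
  height of \<open>\<eta>\<close> is of order \<open>H(x\<^sub>1, y\<^sub>1)\<^sup>e\<close>; as the Wronskian of \<open>P\<close> and \<open>Q\<close> has degree below \<open>d\<close>, it does
  not vanish at \<open>\<alpha>\<close>, so \<open>\<bar>\<alpha> - \<xi>\<bar>\<close> is at most of order \<open>\<bar>\<beta> - \<eta>\<bar>\<close>. For \<open>e \<ge> 2\<close> this contradicts
  Liouville's inequality because \<open>2 \<mu> > d + 2\<close>, and for \<open>e = 1\<close> it is (ii).

  All auxiliary polynomials solve homogeneous linear systems with bounded integer coefficients, so they can
  be bounded explicitly in terms of the codes of the minimal polynomial of \<open>\<alpha>\<close> and the
  coordinates of \<open>\<beta>\<close>. The bounds needed on both constants are linear in \<open>C\<^sub>0\<close>, so a single
  constant \<open>2\<^sup>L C\<^sub>0\<close> serves for both; scaling by a power of two makes its approximations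
  shifted approximations of \<open>C\<^sub>0\<close>.
\<close>

section \<open>Bounded relations between integer polynomials\<close>

text \<open>One step of Gaussian elimination without division: a solution \<open>y\<close> of the system reduced by the
  pivot \<open>a j\<close> extends to the index \<open>j\<close>.\<close>

lemma sum_pivot:
  fixes a b y :: "'i \<Rightarrow> int"
  assumes "finite I" "j \<in> I"
  shows "(\<Sum>i\<in>I. b i * (if i = j then - (\<Sum>i\<in>I - {j}. a i * y i) else a j * y i)) =
         (\<Sum>i\<in>I - {j}. (a j * b i - b j * a i) * y i)"
proof -
  have "(\<Sum>i\<in>I. b i * (if i = j then - (\<Sum>i\<in>I - {j}. a i * y i) else a j * y i)) =
     - b j * (\<Sum>i\<in>I - {j}. a i * y i) + (\<Sum>i\<in>I - {j}. b i * (a j * y i))"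
    using assms by (simp add: sum.remove[of I j])
  also have "\<dots> = (\<Sum>i\<in>I - {j}. (a j * b i - b j * a i) * y i)"
    by (simp add: sum_distrib_left sum.distrib[symmetric] sum_negf[symmetric])
      (rule sum.cong, simp_all add: algebra_simps)
  finally show ?thesis .
qed

text \<open>Induction on the equations: one with a nonzero coefficient serves as pivot and
  disappears together with one unknown, so the count stays favourable; one without imposes
  nothing.\<close>

lemma linear_system_nontrivial_solution:
  fixes a :: "'k \<Rightarrow> 'i \<Rightarrow> int"
  assumes "finite K" "finite I" "card K < card I"
  shows "\<exists>x. (\<exists>i\<in>I. x i \<noteq> 0) \<and> (\<forall>k\<in>K. (\<Sum>i\<in>I. a k i * x i) = 0)"
  using assms
proof (induction K arbitrary: I a rule: finite_induct)
  case empty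
  then have "I \<noteq> {}" by auto
  then show ?case by (intro exI[of _ "\<lambda>_. 1"]) auto
next
  case (insert k K)
  show ?case
  proof (cases "\<exists>j\<in>I. a k j \<noteq> 0")
    case True
    then obtain j where j: "j \<in> I" "a k j \<noteq> 0" by blast
    let ?a = "\<lambda>l i. a k j * a l i - a l j * a k i"
    from insert j have "card K < card (I - {j})" by (simp add: card_Diff_singleton_if)
    then obtain y where y: "\<exists>i\<in>I - {j}. y i \<noteq> 0"
        "\<forall>l\<in>K. (\<Sum>i\<in>I - {j}. ?a l i * y i) = 0"
      using insert.IH[of "I - {j}" ?a] insert.prems by auto
    let ?x = "\<lambda>i. if i = j then - (\<Sum>i\<in>I - {j}. a k i * y i) else a k j * y i"
    have "(\<Sum>i\<in>I. a l i * ?x i) = (\<Sum>i\<in>I - {j}. ?a l i * y i)" for l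
      by (rule sum_pivot) (use insert j in auto)
    moreover have "\<exists>i\<in>I. ?x i \<noteq> 0" using y(1) j by auto
    ultimately show ?thesis using y(2) by (intro exI[of _ ?x]) auto
  next
    case False
    then show ?thesis using insert.IH[of I a] insert by auto
  qed
qed

text \<open>Solvability is assumed rather than derived from a count, and the equations form an
  arbitrary set, because some of the systems treated below are solvable for other reasons. The
  induction is on the unknowns: each elimination replaces \<open>B\<close> by
  \<open>2 * B\<^sup>2\<close> and removes one unknown, so the bound depends on
  \<open>card I\<close> and \<open>B\<close> only.\<close>

lemma linear_system_bounded_solution:
  fixes S :: "('i \<Rightarrow> int) set" and B :: nat
  assumes "finite I" "\<And>b i. b \<in> S \<Longrightarrow> i \<in> I \<Longrightarrow> \<bar>b i\<bar> \<le> int B" "1 \<le> B"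
    and "\<exists>i\<in>I. x i \<noteq> 0" "\<And>b. b \<in> S \<Longrightarrow> (\<Sum>i\<in>I. b i * x i) = 0"
  shows "\<exists>y. (\<exists>i\<in>I. y i \<noteq> 0) \<and> (\<forall>b\<in>S. (\<Sum>i\<in>I. b i * y i) = 0) \<and>
           (\<forall>i\<in>I. \<bar>y i\<bar> \<le> int ((2 * card I * B) ^ (3 ^ card I)))"
  using assms
proof (induction "card I" arbitrary: I S B x)
  case 0
  then show ?case by auto
next
  case (Suc n)
  show ?case
  proof (cases "\<exists>a\<in>S. \<exists>j\<in>I. a j \<noteq> 0")
    case False
    have "(1::int) \<le> int ((2 * card I * B) ^ (3 ^ card I))"
      using Suc by (simp flip: of_nat_power of_nat_mult add: Suc_le_eq)
    moreover have "\<exists>i. i \<in> I" using Suc by auto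
    ultimately show ?thesis using False by (intro exI[of _ "\<lambda>_. 1"]) auto
  next
    case True
    then obtain a j where a: "a \<in> S" and j: "j \<in> I" "a j \<noteq> 0" by blast
    let ?r = "\<lambda>b i. a j * b i - b j * a i"
    have n: "card (I - {j}) = n" using Suc j by (simp add: card_Diff_singleton_if)
    have bd: "\<bar>c i\<bar> \<le> int (2 * B\<^sup>2)" if c: "c \<in> ?r ` S" and i: "i \<in> I - {j}" for c i
    proof -
      from c obtain b where b: "b \<in> S" "c = ?r b" by auto
      have "\<bar>c i\<bar> \<le> \<bar>a j\<bar> * \<bar>b i\<bar> + \<bar>b j\<bar> * \<bar>a i\<bar>"
        unfolding b using abs_triangle_ineq4[of "a j * b i" "b j * a i"] by (simp add: abs_mult)
      also have "\<dots> \<le> int B * int B + int B * int B"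
        by (intro add_mono mult_mono) (use Suc.prems(2) a b j i in auto)
      finally show ?thesis by (simp add: power2_eq_square)
    qed
    have zero: "(\<Sum>i\<in>I - {j}. c i * x i) = 0" if c: "c \<in> ?r ` S" for c
    proof -
      from c obtain b where b: "b \<in> S" "c = ?r b" by auto
      have "(\<Sum>i\<in>I - {j}. c i * x i) =
          a j * (\<Sum>i\<in>I - {j}. b i * x i) - b j * (\<Sum>i\<in>I - {j}. a i * x i)"
        unfolding b by (simp add: sum_distrib_left algebra_simps sum_subtractf)
      moreover have "(\<Sum>i\<in>I - {j}. b i * x i) = - b j * x j"
        using Suc.prems(5)[OF b(1)] sum.remove[OF Suc.prems(1) j(1), of "\<lambda>i. b i * x i"] by simp
      moreover have "(\<Sum>i\<in>I - {j}. a i * x i) = - a j * x j"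
        using Suc.prems(5)[OF a] sum.remove[OF Suc.prems(1) j(1), of "\<lambda>i. a i * x i"] by simp
      ultimately show ?thesis by simp
    qed
    \<comment> \<open>The old solution survives the restriction: if it lived on \<open>j\<close>
      alone, the pivot equation would read \<open>a j * x j = 0\<close>.\<close>
    have nz: "\<exists>i\<in>I - {j}. x i \<noteq> 0"
    proof (rule ccontr)
      assume H: "\<not> ?thesis"
      then have "(\<Sum>i\<in>I - {j}. a i * x i) = 0" by (intro sum.neutral) auto
      then have "a j * x j = 0"
        using Suc.prems(5)[OF a] sum.remove[OF Suc.prems(1) j(1), of "\<lambda>i. a i * x i"] by simp
      then show False using H j Suc.prems(4) by auto
    qed
    obtain y where y: "\<exists>i\<in>I - {j}. y i \<noteq> 0" "\<forall>b\<in>?r ` S. (\<Sum>i\<in>I - {j}. b i * y i) = 0"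
        "\<forall>i\<in>I - {j}. \<bar>y i\<bar> \<le> int ((2 * n * (2 * B\<^sup>2)) ^ (3 ^ n))"
      using Suc.hyps(1)[of "I - {j}" "?r ` S" "2 * B\<^sup>2" x] n Suc.prems bd zero nz by auto
    let ?x = "\<lambda>i. if i = j then - (\<Sum>i\<in>I - {j}. a i * y i) else a j * y i"
    let ?G = "(2 * n * (2 * B\<^sup>2)) ^ (3 ^ n)"
    have "(\<Sum>i\<in>I. b i * ?x i) = (\<Sum>i\<in>I - {j}. ?r b i * y i)" for b
      by (rule sum_pivot) (use Suc j in auto)
    then have 1: "\<forall>b\<in>S. (\<Sum>i\<in>I. b i * ?x i) = 0" using y(2) by auto
    have 2: "\<exists>i\<in>I. ?x i \<noteq> 0" using y(1) j by auto
    \<comment> \<open>In terms of the base \<open>2 * Suc n * B\<close>, the bound for the reduced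
      system is at most the square raised to \<open>3 ^ n\<close>, and back-substitution costs one
      more factor; \<open>1 + 2 * 3 ^ n\<close> is at most \<open>3 ^ Suc n\<close>.\<close>
    have "Suc n * B * ?G \<le> (2 * Suc n * B) ^ (3 ^ Suc n)"
    proof -
      have "2 * n * (2 * B\<^sup>2) \<le> (2 * Suc n * B) ^ 2"
        by (simp add: power2_eq_square algebra_simps)
      then have "?G \<le> ((2 * Suc n * B) ^ 2) ^ (3 ^ n)" by (rule power_mono) simp
      then have "Suc n * B * ?G \<le> (2 * Suc n * B) * ((2 * Suc n * B) ^ 2) ^ (3 ^ n)"
        by (intro mult_mono) auto
      also have "\<dots> = (2 * Suc n * B) ^ (1 + 2 * 3 ^ n)"
        by (simp only: power_mult power_add power_one_right)
      also have "\<dots> \<le> (2 * Suc n * B) ^ (3 ^ Suc n)"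
      proof (rule power_increasing)
        have "1 \<le> (3::nat) ^ n" by simp
        then show "1 + 2 * 3 ^ n \<le> (3::nat) ^ Suc n" by simp
        show "1 \<le> 2 * Suc n * B" using Suc.prems(3) by simp
      qed
      finally show ?thesis .
    qed
    then have G: "int (Suc n) * int B * int ?G \<le> int ((2 * card I * B) ^ (3 ^ card I))"
      using Suc.hyps(2) by (metis of_nat_le_iff of_nat_mult)
    have 3: "\<bar>?x i\<bar> \<le> int ((2 * card I * B) ^ (3 ^ card I))" if i: "i \<in> I" for i
    proof (cases "i = j")
      case True
      have "\<bar>?x i\<bar> \<le> (\<Sum>i\<in>I - {j}. \<bar>a i * y i\<bar>)" using True by (simp add: sum_abs)
      also have "\<dots> \<le> (\<Sum>i\<in>I - {j}. int B * int ?G)"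
        unfolding abs_mult by (intro sum_mono mult_mono) (use y a Suc.prems in auto)
      also have "\<dots> = int n * (int B * int ?G)" using n by simp
      also have "\<dots> \<le> int (Suc n) * (int B * int ?G)" by (intro mult_right_mono) auto
      finally show ?thesis using G by (simp only: mult.assoc)
    next
      case False
      then have "\<bar>?x i\<bar> \<le> int B * int ?G"
        using y(3) i a j Suc.prems(2) by (simp add: abs_mult) (intro mult_mono, auto)
      also have "\<dots> \<le> int (Suc n) * (int B * int ?G)"
        using mult_right_mono[of 1 "int (Suc n)" "int B * int ?G"] by simp
      finally show ?thesis using G by (simp only: mult.assoc)
    qed
    show ?thesis using 1 2 3 by (intro exI[of _ ?x]) blast
  qed
qed

text \<open>Turns a polynomial relation into a linear system: the unknowns are the coefficients of
  the multipliers \<open>U c\<close>, indexed by pairs \<open>(c, i)\<close> with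
  \<open>i < m c\<close>, and each \<open>k\<close> gives one equation whose coefficients are zero
  or coefficients of the \<open>A c\<close>.\<close>

lemma coeff_sum_mult:
  fixes U A :: "'c \<Rightarrow> int poly"
  assumes "\<And>c i. c \<in> J \<Longrightarrow> m c \<le> i \<Longrightarrow> coeff (U c) i = 0" and "finite J"
  shows "coeff (\<Sum>c\<in>J. U c * A c) k =
    (\<Sum>(c, i)\<in>Sigma J (\<lambda>c. {..<m c}). (if i \<le> k then coeff (A c) (k - i) else 0) * coeff (U c) i)"
proof -
  have "coeff (U c * A c) k = (\<Sum>i<m c. (if i \<le> k then coeff (A c) (k - i) else 0) * coeff (U c) i)"
    if c: "c \<in> J" for c
  proof -
    have "coeff (U c * A c) k = (\<Sum>i\<le>k. coeff (A c) (k - i) * coeff (U c) i)"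
      unfolding coeff_mult by (simp add: mult.commute)
    also have "\<dots> = (\<Sum>i\<in>{..k} \<union> {..<m c}. (if i \<le> k then coeff (A c) (k - i) else 0) * coeff (U c) i)"
      by (rule sum.mono_neutral_cong_left) auto
    also have "\<dots> = (\<Sum>i<m c. (if i \<le> k then coeff (A c) (k - i) else 0) * coeff (U c) i)"
      by (rule sum.mono_neutral_right) (use assms(1)[OF c] in auto)
    finally show ?thesis .
  qed
  then show ?thesis using assms(2) by (simp add: coeff_sum sum.Sigma)
qed

section \<open>Existence and size of polynomial relations\<close>

definition poly_of_fun :: "nat \<Rightarrow> (nat \<Rightarrow> int) \<Rightarrow> int poly" where
  "poly_of_fun m f = Poly (map f [0..<m])"

lemma coeff_poly_of_fun: "coeff (poly_of_fun m f) i = (if i < m then f i else 0)"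
  by (simp add: poly_of_fun_def nth_default_def)

text \<open>The products \<open>U c * A c\<close> have no coefficients from index \<open>n\<close>
  on, so only \<open>n\<close> equations remain for more than \<open>n\<close> unknowns.\<close>

lemma poly_relation_nontrivial:
  fixes A :: "'c \<Rightarrow> int poly"
  assumes "finite J" "n < (\<Sum>c\<in>J. m c)"
    and "\<And>c. c \<in> J \<Longrightarrow> m c + degree (A c) \<le> n"
  shows "\<exists>U. (\<exists>c\<in>J. U c \<noteq> 0) \<and> (\<forall>c\<in>J. \<forall>i\<ge>m c. coeff (U c) i = 0) \<and>
             (\<Sum>c\<in>J. U c * A c) = 0"
proof -
  let ?I = "Sigma J (\<lambda>c. {..<m c})"
  let ?a = "\<lambda>k (c, i). if i \<le> k then coeff (A c) (k - i) else 0"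
  have "card ?I = (\<Sum>c\<in>J. m c)" using assms(1) by (simp add: card_SigmaI)
  then obtain x where x: "\<exists>i\<in>?I. x i \<noteq> 0" "\<forall>k\<in>{..<n}. (\<Sum>i\<in>?I. ?a k i * x i) = 0"
    using linear_system_nontrivial_solution[of "{..<n}" ?I ?a] assms by auto
  define U where "U c = poly_of_fun (m c) (\<lambda>i. x (c, i))" for c
  have deg: "\<forall>c\<in>J. \<forall>i\<ge>m c. coeff (U c) i = 0" by (simp add: U_def coeff_poly_of_fun)
  have co: "coeff (\<Sum>c\<in>J. U c * A c) k = (\<Sum>i\<in>?I. ?a k i * x i)" for k
    using deg assms(1) by (subst coeff_sum_mult[where m = m])
      (auto intro!: sum.cong simp: U_def coeff_poly_of_fun)
  have "(\<Sum>i\<in>?I. ?a k i * x i) = 0" if "k \<ge> n" for k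
    using assms(3) that by (intro sum.neutral) (fastforce intro!: coeff_eq_0)
  then have "(\<Sum>c\<in>J. U c * A c) = 0"
    by (intro poly_eqI) (metis co x(2) coeff_0 lessThan_iff linorder_not_le)
  moreover obtain c i where "c \<in> J" "i < m c" "x (c, i) \<noteq> 0" using x(1) by auto
  then have "\<exists>c\<in>J. U c \<noteq> 0"
    by (metis U_def coeff_0 coeff_poly_of_fun)
  ultimately show ?thesis using deg by blast
qed

text \<open>Any nontrivial relation of a given shape yields one of bounded size. The bound involves
  only an upper estimate \<open>n\<close> for the number of unknowns, so it can be fixed before the
  shape is known.\<close>

lemma poly_relation_bounded:
  fixes A :: "'c \<Rightarrow> int poly"
  assumes "finite J" "\<And>c i. c \<in> J \<Longrightarrow> \<bar>coeff (A c) i\<bar> \<le> int B" "1 \<le> B"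
    and U: "\<exists>c\<in>J. U c \<noteq> 0" "\<And>c i. c \<in> J \<Longrightarrow> m c \<le> i \<Longrightarrow> coeff (U c) i = 0"
      "(\<Sum>c\<in>J. U c * A c) = 0"
    and n: "(\<Sum>c\<in>J. m c) \<le> n"
  shows "\<exists>U. (\<exists>c\<in>J. U c \<noteq> 0) \<and> (\<forall>c\<in>J. \<forall>i\<ge>m c. coeff (U c) i = 0) \<and>
             (\<Sum>c\<in>J. U c * A c) = 0 \<and>
             (\<forall>c\<in>J. \<forall>i. \<bar>coeff (U c) i\<bar> \<le> int ((2 * n * B) ^ (3 ^ n)))"
proof -
  let ?I = "Sigma J (\<lambda>c. {..<m c})"
  let ?a = "\<lambda>k (c, i). if i \<le> k then coeff (A c) (k - i) else 0"
  have cI: "card ?I = (\<Sum>c\<in>J. m c)" using assms(1) by (simp add: card_SigmaI)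
  obtain c i where ci: "c \<in> J" "coeff (U c) i \<noteq> 0"
    using U(1) by (metis coeff_0 poly_eqI)
  have "(\<Sum>z\<in>?I. ?a k z * (\<lambda>(c, i). coeff (U c) i) z) = 0" for k
    using coeff_sum_mult[of J m U A k] U assms(1) by (simp add: case_prod_unfold)
  moreover have "\<exists>z\<in>?I. (\<lambda>(c, i). coeff (U c) i) z \<noteq> 0"
    using ci U(2) by (intro bexI[of _ "(c, i)"]) (auto simp: not_le[symmetric])
  moreover have "finite ?I" using assms(1) by auto
  moreover have "\<bar>b z\<bar> \<le> int B" if "b \<in> range ?a" "z \<in> ?I" for b z
    using that assms(2) by auto
  ultimately obtain x where x: "\<exists>i\<in>?I. x i \<noteq> 0" "\<forall>b\<in>range ?a. (\<Sum>i\<in>?I. b i * x i) = 0"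
      "\<forall>i\<in>?I. \<bar>x i\<bar> \<le> int ((2 * card ?I * B) ^ (3 ^ card ?I))"
    using linear_system_bounded_solution[of ?I "range ?a" B "\<lambda>(c, i). coeff (U c) i"] assms(3)
    by blast
  define V where "V c = poly_of_fun (m c) (\<lambda>i. x (c, i))" for c
  have deg: "\<forall>c\<in>J. \<forall>i\<ge>m c. coeff (V c) i = 0" by (simp add: V_def coeff_poly_of_fun)
  have co: "coeff (\<Sum>c\<in>J. V c * A c) k = (\<Sum>i\<in>?I. ?a k i * x i)" for k
    using deg assms(1) by (subst coeff_sum_mult[where m = m])
      (auto intro!: sum.cong simp: V_def coeff_poly_of_fun)
  then have "(\<Sum>c\<in>J. V c * A c) = 0" using x(2) by (intro poly_eqI) auto
  moreover obtain c i where "c \<in> J" "i < m c" "x (c, i) \<noteq> 0" using x(1) by auto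
  then have "\<exists>c\<in>J. V c \<noteq> 0" by (metis V_def coeff_0 coeff_poly_of_fun)
  moreover have "\<bar>coeff (V c) i\<bar> \<le> int ((2 * n * B) ^ (3 ^ n))" if "c \<in> J" for c i
  proof (cases "i < m c")
    case True
    have "1 \<le> (\<Sum>c\<in>J. m c)"
      using True member_le_sum[of c J m] that assms(1) by simp
    then have "1 \<le> 2 * card ?I * B" using cI assms(3) by (simp add: Suc_le_eq)
    then have "1 \<le> 2 * n * B" using n cI assms(3) by (simp add: Suc_le_eq)
    have "(2 * card ?I * B) ^ (3 ^ card ?I) \<le> (2 * n * B) ^ (3 ^ card ?I)"
      using n cI by (intro power_mono) auto
    also have "\<dots> \<le> (2 * n * B) ^ (3 ^ n)"
      using n cI \<open>1 \<le> 2 * n * B\<close> by (intro power_increasing) (auto intro: power_increasing)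
    finally have "int ((2 * card ?I * B) ^ (3 ^ card ?I)) \<le> int ((2 * n * B) ^ (3 ^ n))"
      by (simp only: of_nat_le_iff)
    moreover have "\<bar>x (c, i)\<bar> \<le> int ((2 * card ?I * B) ^ (3 ^ card ?I))"
      using x(3) that True by blast
    ultimately have "\<bar>x (c, i)\<bar> \<le> int ((2 * n * B) ^ (3 ^ n))" by (rule order_trans[rotated])
    then show ?thesis using True by (simp only: V_def coeff_poly_of_fun if_True)
  qed (simp add: V_def coeff_poly_of_fun)
  ultimately show ?thesis using deg by blast
qed

text \<open>The bound of \<open>poly_relation_bounded\<close> for coefficients at most
  \<open>T\<close> and at most \<open>3 * T\<close> unknowns.\<close>

definition relation_bound :: "nat \<Rightarrow> nat" where
  "relation_bound T = (6 * T * T) ^ (3 ^ (3 * T))"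

text \<open>For polynomials of degree at most \<open>n\<close>, with \<open>n\<close> at least 1,
  this is coprimality of their homogenisations of degree \<open>n\<close>, that is, a nonzero
  resultant. A common zero at infinity is excluded too, so one of the degrees equals
  \<open>n\<close>.\<close>

definition no_relation_below :: "nat \<Rightarrow> int poly \<Rightarrow> int poly \<Rightarrow> bool" where
  "no_relation_below n A B \<longleftrightarrow>
     (\<forall>U V. degree U < n \<longrightarrow> degree V < n \<longrightarrow> U * A + V * B = 0 \<longrightarrow> U = 0 \<and> V = 0)"

lemma no_relation_belowD:
  "no_relation_below n A B \<Longrightarrow> degree U < n \<Longrightarrow> degree V < n \<Longrightarrow> U * A + V * B = 0 \<Longrightarrow> U = 0 \<and> V = 0"
  by (simp add: no_relation_below_def)

text \<open>
  Homogenised at coprime \<open>x\<close>, \<open>y\<close>, the cases \<open>j = 0\<close> and \<open>j = 2 n - 1\<close> show that a common factor of the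
  values of \<open>A\<close> and \<open>B\<close> divides multiples of \<open>y ^ (2 n - 1)\<close> and of \<open>x ^ (2 n - 1)\<close> by bounded
  constants, so it is bounded itself.
\<close>

lemma bezout_bounded:
  fixes A B :: "int poly"
  assumes deg: "degree A \<le> n" "degree B \<le> n" and n: "1 \<le> n" "n \<le> T"
    and co: "\<And>i. \<bar>coeff A i\<bar> \<le> int T" "\<And>i. \<bar>coeff B i\<bar> \<le> int T"
    and norel: "no_relation_below n A B"
    and j: "j < 2 * n"
  shows "\<exists>U V r. r \<noteq> 0 \<and> \<bar>r\<bar> \<le> int (relation_bound T) \<and> degree U < n \<and> degree V < n \<and>
    (\<forall>i. \<bar>coeff U i\<bar> \<le> int (relation_bound T)) \<and> (\<forall>i. \<bar>coeff V i\<bar> \<le> int (relation_bound T)) \<and>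
    U * A + V * B = monom r j"
proof -
  \<comment> \<open>The third polynomial gets a constant multiplier, which becomes \<open>r\<close>.
    This makes \<open>2 * n + 1\<close> unknowns against \<open>2 * n\<close> equations.\<close>
  define C :: "nat \<Rightarrow> int poly" where "C = (\<lambda>c. [A, B, - monom 1 j] ! c)"
  define m :: "nat \<Rightarrow> nat" where "m = (\<lambda>c. [n, n, 1] ! c)"
  have J: "{..<3} = {0, 1, 2::nat}" by auto
  have ms: "(\<Sum>c<3. m c) = 2 * n + 1" by (simp add: J m_def)
  have md: "m c + degree (C c) \<le> 2 * n" if "c \<in> {..<3}" for c
    using that deg j unfolding J by (auto simp: C_def m_def degree_monom_eq)
  have mc: "\<bar>coeff (C c) i\<bar> \<le> int T" if "c \<in> {..<3}" for c i
    using that co n unfolding J by (auto simp: C_def)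
  obtain W where W: "\<exists>c\<in>{..<3}. W c \<noteq> 0" "\<forall>c\<in>{..<3}. \<forall>i\<ge>m c. coeff (W c) i = 0"
      "(\<Sum>c\<in>{..<3}. W c * C c) = 0"
    using poly_relation_nontrivial[of "{..<3}" "2 * n" m C] ms md by auto
  obtain U where U: "\<exists>c\<in>{..<3}. U c \<noteq> 0" "\<forall>c\<in>{..<3}. \<forall>i\<ge>m c. coeff (U c) i = 0"
      "(\<Sum>c\<in>{..<3}. U c * C c) = 0"
      "\<forall>c\<in>{..<3}. \<forall>i. \<bar>coeff (U c) i\<bar> \<le> int ((2 * (3 * T) * T) ^ (3 ^ (3 * T)))"
    using poly_relation_bounded[of "{..<3}" C T W m "3 * T"] mc W ms n by auto
  define r where "r = coeff (U 2) 0"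
  have U2: "U 2 = [:r:]"
    using U(2) by (intro poly_eqI) (auto simp: J m_def r_def coeff_pCons split: nat.splits)
  have eq: "U 0 * A + U 1 * B = monom r j"
    using U(3) unfolding J by (simp add: C_def U2 smult_monom)
  have d: "degree (U 0) < n" "degree (U 1) < n"
    using U(2) n unfolding J
    by (auto simp: m_def intro!: le_less_trans[OF degree_le, of "n - 1"])
  \<comment> \<open>With \<open>r = 0\<close> the identity would be a forbidden relation between
    \<open>A\<close> and \<open>B\<close>, and all three multipliers would vanish.\<close>
  have "r \<noteq> 0"
  proof
    assume "r = 0"
    then have "U 0 = 0" "U 1 = 0" "U 2 = 0" using no_relation_belowD[OF norel d] eq U2 by auto
    then show False using U(1) unfolding J by simp
  qed
  then show ?thesis using U(4) d eq unfolding J relation_bound_def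
    by (intro exI[of _ "U 0"] exI[of _ "U 1"] exI[of _ r]) (auto simp: r_def)
qed

section \<open>Minimal polynomials and coordinates\<close>

lemma rpoly_add: "rpoly (p + q) x = rpoly p x + rpoly q x"
proof -
  have "map_poly of_rat (p + q) = (map_poly of_rat p + map_poly of_rat q :: real poly)"
    by (intro poly_eqI) (simp add: coeff_map_poly of_rat_add)
  then show ?thesis by (simp add: rpoly_def)
qed

lemma rpoly_smult: "rpoly (smult c p) x = of_rat c * rpoly p x"
proof -
  have "map_poly of_rat (smult c p) = (smult (of_rat c) (map_poly of_rat p) :: real poly)"
    by (intro poly_eqI) (simp add: coeff_map_poly of_rat_mult)
  then show ?thesis by (simp add: rpoly_def)
qed

lemma rpoly_0 [simp]: "rpoly 0 x = 0"
  by (simp add: rpoly_def)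

lemma rpoly_pCons [simp]: "rpoly (pCons a p) x = of_rat a + x * rpoly p x"
  by (simp add: rpoly_def map_poly_pCons)

lemma rpoly_mult: "rpoly (p * q) x = rpoly p x * rpoly q x"
  by (induction p) (simp_all add: rpoly_add rpoly_smult algebra_simps)

lemma rpoly_minus: "rpoly (- p) x = - rpoly p x"
  using rpoly_smult[of "-1" p x] by simp

lemma rpoly_mod: "rpoly m x = 0 \<Longrightarrow> rpoly (p mod m) x = rpoly p x"
  using rpoly_add[of "p div m * m" "p mod m" x] by (simp add: rpoly_mult)

lemma rpoly_altdef: "rpoly p x = (\<Sum>i\<le>degree p. of_rat (coeff p i) * x ^ i)"
  by (simp add: rpoly_def poly_altdef coeff_map_poly degree_map_poly)

lemma rpoly_of_int_poly: "rpoly (map_poly of_int P) x = poly (map_poly of_int P) x"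
  by (simp add: rpoly_def map_poly_map_poly comp_def)

lemma of_int_poly_add:
  "map_poly of_int (P + Q) = (map_poly of_int P + map_poly of_int Q :: 'a::{comm_ring_1,ring_char_0} poly)"
  by (intro poly_eqI) (simp add: coeff_map_poly)

lemma of_int_poly_diff:
  "map_poly of_int (P - Q) = (map_poly of_int P - map_poly of_int Q :: 'a::{comm_ring_1,ring_char_0} poly)"
  by (intro poly_eqI) (simp add: coeff_map_poly)

lemma of_int_poly_smult:
  "map_poly of_int (smult c Q) = (smult (of_int c) (map_poly of_int Q) :: 'a::{comm_ring_1,ring_char_0} poly)"
  by (intro poly_eqI) (simp add: coeff_map_poly)

lemma of_int_poly_mult:
  "map_poly of_int (P * Q) = (map_poly of_int P * map_poly of_int Q :: 'a::{comm_ring_1,ring_char_0} poly)"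
  by (induction P) (simp_all add: map_poly_pCons of_int_poly_add of_int_poly_smult)

lemma of_int_poly_pderiv:
  "map_poly of_int (pderiv P) = (pderiv (map_poly of_int P) :: 'a::{idom,ring_char_0} poly)"
  by (intro poly_eqI) (simp add: coeff_map_poly coeff_pderiv)

lemma monic_degree_0: "degree p = 0 \<Longrightarrow> lead_coeff p = 1 \<Longrightarrow> p = 1"
  by (elim degree_eq_zeroE) (simp add: one_pCons)

section \<open>Existence and uniqueness of the minimal polynomial\<close>

lemma algebraic_imp_rpoly:
  assumes "algebraic \<alpha>"
  shows "\<exists>f. f \<noteq> 0 \<and> rpoly f \<alpha> = 0"
proof -
  from assms obtain g :: "int poly" where g: "g \<noteq> 0" "poly (map_poly of_int g) \<alpha> = 0"
    by (rule algebraicE')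
  then show ?thesis
    by (intro exI[of _ "map_poly of_int g"]) (simp add: rpoly_of_int_poly map_poly_eq_0_iff)
qed

lemma least_degree_annihilator:
  assumes "algebraic \<alpha>"
  shows "\<exists>p. lead_coeff p = 1 \<and> rpoly p \<alpha> = 0 \<and> (\<forall>f. rpoly f \<alpha> = 0 \<longrightarrow> f = 0 \<or> degree p \<le> degree f)"
proof -
  obtain f where f: "f \<noteq> 0 \<and> rpoly f \<alpha> = 0"
      "\<And>g. g \<noteq> 0 \<and> rpoly g \<alpha> = 0 \<Longrightarrow> degree f \<le> degree g"
    using ex_has_least_nat[of "\<lambda>f. f \<noteq> 0 \<and> rpoly f \<alpha> = 0" _ degree]
      algebraic_imp_rpoly[OF assms] by metis
  show ?thesis
  proof (intro exI conjI allI impI)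
    show "lead_coeff (smult (inverse (lead_coeff f)) f) = 1" using f by simp
    show "rpoly (smult (inverse (lead_coeff f)) f) \<alpha> = 0" using f by (simp add: rpoly_smult)
    show "g = 0 \<or> degree (smult (inverse (lead_coeff f)) f) \<le> degree g"
      if "rpoly g \<alpha> = 0" for g using f(2)[of g] that by auto
  qed
qed

text \<open>In a factorisation one factor vanishes at \<open>\<alpha>\<close>, hence has full
  degree, and the other one is constant.\<close>

lemma least_degree_irreducible:
  assumes p: "lead_coeff p = 1" "rpoly p \<alpha> = 0"
    and min: "\<And>f. rpoly f \<alpha> = 0 \<Longrightarrow> f = 0 \<or> degree p \<le> degree f"
  shows "irreducible p"
proof (rule irreducibleI)
  show "p \<noteq> 0" using p by auto
  show "\<not> p dvd 1"
  proof
    assume "p dvd 1"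
    then have "degree p = 0" using \<open>p \<noteq> 0\<close> by (simp add: is_unit_iff_degree)
    with p(1) have "p = 1" by (blast intro: monic_degree_0)
    then show False using p(2) by (simp add: rpoly_altdef)
  qed
  fix a b assume ab: "p = a * b"
  then have nz: "a \<noteq> 0" "b \<noteq> 0" using \<open>p \<noteq> 0\<close> by auto
  then have "degree p = degree a + degree b" using ab by (simp add: degree_mult_eq)
  moreover have "rpoly a \<alpha> = 0 \<or> rpoly b \<alpha> = 0" using p(2) ab by (simp add: rpoly_mult)
  then have "degree p \<le> degree a \<or> degree p \<le> degree b" using min nz by auto
  ultimately show "a dvd 1 \<or> b dvd 1" using nz by (auto simp: is_unit_iff_degree)
qed

text \<open>The definite description is justified by division with remainder: a monic annihilator of
  least degree divides every annihilator, so an irreducible monic annihilator coincides with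
  it.\<close>

lemma min_poly:
  assumes "algebraic \<alpha>"
  shows "lead_coeff (min_poly \<alpha>) = 1" "irreducible (min_poly \<alpha>)" "rpoly (min_poly \<alpha>) \<alpha> = 0"
    and "\<And>f. rpoly f \<alpha> = 0 \<Longrightarrow> min_poly \<alpha> dvd f"
proof -
  obtain p where p: "lead_coeff p = 1" "rpoly p \<alpha> = 0"
      "\<And>f. rpoly f \<alpha> = 0 \<Longrightarrow> f = 0 \<or> degree p \<le> degree f"
    using least_degree_annihilator[OF assms] by blast
  have p0: "p \<noteq> 0" using p(1) by auto
  have dvd: "p dvd f" if "rpoly f \<alpha> = 0" for f
  proof -
    have "rpoly (f mod p) \<alpha> = 0" using that p(2) by (simp add: rpoly_mod)
    then have "f mod p = 0" using p(3) degree_mod_less[OF p0, of f] by fastforce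
    then show ?thesis by (simp add: dvd_eq_mod_eq_0)
  qed
  have irr: "irreducible p" using least_degree_irreducible p by blast
  have "min_poly \<alpha> = p" unfolding min_poly_def
  proof (rule the_equality)
    show "lead_coeff p = 1 \<and> irreducible p \<and> rpoly p \<alpha> = 0" using p irr by simp
    fix q assume q: "lead_coeff q = 1 \<and> irreducible q \<and> rpoly q \<alpha> = 0"
    then obtain c where c: "q = p * c" using dvd by (metis dvdE)
    moreover have "\<not> p dvd 1" using irr irreducible_not_unit by blast
    ultimately have u: "c dvd 1" using q irreducibleD by blast
    then have "c \<noteq> 0" by auto
    then have "degree c = 0" using u by (simp add: is_unit_iff_degree)
    moreover have "lead_coeff c = 1" using c q p(1) by (simp add: lead_coeff_mult)
    ultimately have "c = 1" by (blast intro: monic_degree_0)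
    then show "q = p" using c by simp
  qed
  then show "lead_coeff (min_poly \<alpha>) = 1" "irreducible (min_poly \<alpha>)" "rpoly (min_poly \<alpha>) \<alpha> = 0"
    "\<And>f. rpoly f \<alpha> = 0 \<Longrightarrow> min_poly \<alpha> dvd f"
    using p irr dvd by auto
qed

section \<open>The field generated by an algebraic number\<close>

lemma rpoly_nonzero_below_degree:
  assumes "algebraic \<alpha>" "f \<noteq> 0" "degree f < degree (min_poly \<alpha>)"
  shows "rpoly f \<alpha> \<noteq> 0"
  using min_poly(4)[OF assms(1), of f] dvd_imp_degree_le[of "min_poly \<alpha>" f] assms(2,3) by force

text \<open>Euclid's algorithm on the minimal polynomial and \<open>f\<close>: at
  \<open>\<alpha>\<close> the remainder is, up to sign, a multiple of \<open>f\<close>, so an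
  inverse for the remainder yields one for \<open>f\<close>. A zero remainder forces
  \<open>f\<close> to be a unit by irreducibility.\<close>

lemma rpoly_inverse:
  assumes "algebraic \<alpha>" "f \<noteq> 0" "degree f < degree (min_poly \<alpha>)"
  shows "\<exists>g. rpoly g \<alpha> * rpoly f \<alpha> = 1"
  using assms(2,3)
proof (induction "degree f" arbitrary: f rule: less_induct)
  case less
  let ?p = "min_poly \<alpha>"
  have *: "rpoly (?p div f) \<alpha> * rpoly f \<alpha> + rpoly (?p mod f) \<alpha> = 0"
    using min_poly(3)[OF assms(1)] by (simp flip: rpoly_mult rpoly_add)
  show ?case
  proof (cases "?p mod f = 0")
    case True
    then have "f dvd ?p" by (simp add: dvd_eq_mod_eq_0)
    then obtain c where c: "?p = f * c" by (elim dvdE)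
    have "?p \<noteq> 0" using min_poly(1)[OF assms(1)] by auto
    then have "c \<noteq> 0" "degree ?p = degree f + degree c"
      using c less.prems by (auto simp: degree_mult_eq)
    then have "\<not> c dvd 1" using less.prems by (simp add: is_unit_iff_degree)
    then have "f dvd 1" using min_poly(2)[OF assms(1)] c irreducibleD by blast
    then obtain g where "f * g = 1" by (metis dvdE)
    then have "rpoly g \<alpha> * rpoly f \<alpha> = rpoly 1 \<alpha>" by (metis rpoly_mult mult.commute)
    then show ?thesis by (auto simp: rpoly_altdef)
  next
    case False
    then have lt: "degree (?p mod f) < degree f"
      using degree_mod_less[of f ?p] less.prems by auto
    then obtain g where g: "rpoly g \<alpha> * rpoly (?p mod f) \<alpha> = 1"
      using less False by (metis less_trans)
    then have "rpoly (- g * (?p div f)) \<alpha> * rpoly f \<alpha> = 1"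
      using * by (simp add: rpoly_mult rpoly_minus) algebra
    then show ?thesis by blast
  qed
qed

text \<open>The values of rational polynomials at \<open>\<alpha>\<close> form a subfield, which
  therefore contains \<open>rat_adjoin \<alpha>\<close>; reduction modulo the minimal polynomial
  lowers the degree. Uniqueness makes the code stored in \<open>\<phi> 2\<close> a function of
  \<open>\<alpha>\<close> and \<open>\<beta>\<close>.\<close>

lemma rat_adjoin_imp_rpoly:
  assumes "algebraic \<alpha>" "\<beta> \<in> rat_adjoin \<alpha>"
  shows "\<exists>!q. degree q < degree (min_poly \<alpha>) \<and> rpoly q \<alpha> = \<beta>"
proof -
  let ?p = "min_poly \<alpha>"
  let ?K = "range (\<lambda>q. rpoly q \<alpha>)"
  have p0: "?p \<noteq> 0" using min_poly(1)[OF assms(1)] by auto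
  have pdeg: "degree ?p > 0"
    using min_poly(2)[OF assms(1)] p0 irreducible_not_unit is_unit_iff_degree by blast
  have red: "degree (q mod ?p) < degree ?p" for q
    using degree_mod_less[OF p0, of q] pdeg by fastforce
  have "real_subfield ?K" unfolding real_subfield_def
  proof (intro conjI ballI)
    show "0 \<in> ?K" by (rule range_eqI[of _ _ 0]) simp
    show "1 \<in> ?K" by (rule range_eqI[of _ _ "[:1:]"]) simp
    fix x assume "x \<in> ?K"
    then obtain q where q: "x = rpoly q \<alpha>" by blast
    show "- x \<in> ?K" unfolding q by (rule range_eqI[of _ _ "- q"]) (simp add: rpoly_minus)
    show "x + y \<in> ?K" "x * y \<in> ?K" if "y \<in> ?K" for y
    proof -
      from that obtain r where r: "y = rpoly r \<alpha>" by blast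
      show "x + y \<in> ?K" unfolding q r by (rule range_eqI[of _ _ "q + r"]) (simp add: rpoly_add)
      show "x * y \<in> ?K" unfolding q r by (rule range_eqI[of _ _ "q * r"]) (simp add: rpoly_mult)
    qed
    have qm: "rpoly (q mod ?p) \<alpha> = x" using q min_poly(3)[OF assms(1)] by (simp add: rpoly_mod)
    show "inverse x \<in> ?K"
    proof (cases "q mod ?p = 0")
      case True
      then show ?thesis using qm \<open>0 \<in> ?K\<close> by simp
    next
      case False
      then obtain g where "rpoly g \<alpha> * x = 1" using rpoly_inverse[OF assms(1) False red] qm by auto
      then have "inverse x = rpoly g \<alpha>" by (metis inverse_unique mult.commute)
      then show ?thesis by blast
    qed
  qed
  moreover have "\<alpha> \<in> ?K" by (rule range_eqI[of _ _ "[:0, 1:]"]) simp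
  ultimately have "\<beta> \<in> ?K" using assms(2) unfolding rat_adjoin_def by blast
  then obtain q where q: "\<beta> = rpoly q \<alpha>" by blast
  show ?thesis
  proof (rule ex1I[of _ "q mod ?p"])
    show "degree (q mod ?p) < degree ?p \<and> rpoly (q mod ?p) \<alpha> = \<beta>"
      using red q min_poly(3)[OF assms(1)] by (simp add: rpoly_mod)
    fix r assume r: "degree r < degree ?p \<and> rpoly r \<alpha> = \<beta>"
    have "rpoly (r - q mod ?p) \<alpha> = 0"
      using r q rpoly_add[of r "- (q mod ?p)" \<alpha>] min_poly(3)[OF assms(1)]
      by (simp add: rpoly_minus rpoly_mod)
    moreover have "degree (r - q mod ?p) < degree ?p" using r red by (simp add: degree_diff_less)
    ultimately show "r = q mod ?p"
      using rpoly_nonzero_below_degree[OF assms(1), of "r - q mod ?p"] by auto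
  qed
qed

definition coordinate_poly :: "real \<Rightarrow> real \<Rightarrow> rat poly" where
  "coordinate_poly \<alpha> \<beta> = (THE q. degree q < degree (min_poly \<alpha>) \<and> rpoly q \<alpha> = \<beta>)"

lemma coordinate_poly:
  assumes "algebraic \<alpha>" "\<beta> \<in> rat_adjoin \<alpha>"
  shows "degree (coordinate_poly \<alpha> \<beta>) < degree (min_poly \<alpha>)" "rpoly (coordinate_poly \<alpha> \<beta>) \<alpha> = \<beta>"
  using theI'[OF rat_adjoin_imp_rpoly[OF assms]] unfolding coordinate_poly_def by auto

section \<open>Codes of rational polynomials\<close>

lemma abs_le_int_encode: "\<bar>i\<bar> \<le> int (int_encode i)"
  by (auto simp: int_encode_def sum_encode_def)

lemma member_le_list_encode: "x \<in> set xs \<Longrightarrow> x \<le> list_encode xs"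
  by (induction xs) (auto intro: le_SucI order_trans le_prod_encode_1 le_prod_encode_2)

lemma length_le_list_encode: "length xs \<le> list_encode xs"
  by (induction xs) (auto intro: order_trans le_prod_encode_2)

lemma degree_le_encode_rat_poly: "degree p \<le> encode_rat_poly p"
  using length_le_list_encode[of "map encode_rat (coeffs p)"]
  by (cases "p = 0") (auto simp: encode_rat_poly_def length_coeffs_degree)

text \<open>Every nonzero coefficient occurs in the coded list. A zero coefficient may be missing
  from it and has denominator 1 even when the code is 0, hence the \<open>max 1\<close>.\<close>

lemma coeff_le_encode_rat_poly:
  assumes "quotient_of (coeff p i) = (a, b)"
  shows "\<bar>a\<bar> \<le> int (encode_rat_poly p)" "b \<le> int (max 1 (encode_rat_poly p))"
proof -
  have "\<bar>a\<bar> \<le> int (encode_rat_poly p) \<and> b \<le> int (max 1 (encode_rat_poly p))"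
  proof (cases "coeff p i = 0")
    case True
    then show ?thesis using assms by auto
  next
    case False
    then have "coeff p i \<in> set (coeffs p)"
      by (metis coeff_in_coeffs le_degree leading_coeff_0_iff coeff_0)
    then have *: "encode_rat (coeff p i) \<le> encode_rat_poly p"
      unfolding encode_rat_poly_def by (intro member_le_list_encode) auto
    have "int_encode a \<le> encode_rat (coeff p i)" "nat b \<le> encode_rat (coeff p i)"
      using assms by (auto simp: encode_rat_def le_prod_encode_1 le_prod_encode_2)
    then show ?thesis using * abs_le_int_encode[of a] by auto
  qed
  then show "\<bar>a\<bar> \<le> int (encode_rat_poly p)" "b \<le> int (max 1 (encode_rat_poly p))" by auto
qed

text \<open>The number \<open>fact N\<close> is a multiple of every denominator up to
  \<open>N\<close>, so the factor depends on a bound only and can be shared by several polynomials.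
  The floor then merely changes the type.\<close>

definition clear_denominators :: "nat \<Rightarrow> rat poly \<Rightarrow> int poly" where
  "clear_denominators N p = map_poly (\<lambda>r. \<lfloor>fact N * r\<rfloor>) p"

lemma coeff_clear_denominators:
  assumes "\<And>a b. quotient_of (coeff p i) = (a, b) \<Longrightarrow> b \<le> int N"
  shows "of_int (coeff (clear_denominators N p) i) = fact N * coeff p i"
proof -
  obtain a b where ab: "quotient_of (coeff p i) = (a, b)" by fastforce
  have b: "b > 0" "b \<le> int N" using ab assms quotient_of_denom_pos by auto
  then have "nat b dvd fact N" by (intro dvd_fact) auto
  then obtain k where k: "fact N = nat b * k" by (elim dvdE)
  then have "(fact N :: rat) = of_nat (nat b * k)" by (metis of_nat_fact)
  also have "\<dots> = of_int b * of_nat k" using b by simp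
  finally have f: "(fact N :: rat) = of_int b * of_nat k" .
  have "fact N * coeff p i = of_int (int k * a)"
    using quotient_of_div[OF ab] b by (simp add: f)
  then have "of_int \<lfloor>fact N * coeff p i\<rfloor> = fact N * coeff p i" by (metis floor_of_int)
  then show ?thesis by (simp add: clear_denominators_def coeff_map_poly)
qed

lemma of_int_clear_denominators:
  assumes "\<And>i a b. quotient_of (coeff p i) = (a, b) \<Longrightarrow> b \<le> int N"
  shows "map_poly of_int (clear_denominators N p) = smult (fact N) p"
  using coeff_clear_denominators[OF assms] by (intro poly_eqI) (simp add: coeff_map_poly)

lemma ex_clear_denominators: "\<exists>N P. map_poly of_int P = smult (fact N) (p :: rat poly)"
proof -
  \<comment> \<open>The added 1 covers the coefficients beyond the degree, whose denominator is
    1.\<close>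
  define N where "N = (\<Sum>i\<le>degree p. nat (snd (quotient_of (coeff p i)))) + 1"
  have "b \<le> int N" if q: "quotient_of (coeff p i) = (a, b)" for i a b
  proof (cases "i \<le> degree p")
    case True
    then have "nat b \<le> (\<Sum>i\<le>degree p. nat (snd (quotient_of (coeff p i))))"
      using member_le_sum[of i "{..degree p}" "\<lambda>i. nat (snd (quotient_of (coeff p i)))"] q by simp
    then show ?thesis unfolding N_def by linarith
  next
    case False
    then have "b = 1" using q by (auto simp: coeff_eq_0)
    then show ?thesis unfolding N_def by linarith
  qed
  then show ?thesis using of_int_clear_denominators by blast
qed

lemma degree_clear_denominators: "degree (clear_denominators N p) \<le> degree p"
  unfolding clear_denominators_def by (rule map_poly_degree_leq)

section \<open>Computability\<close>

definition total_recursive :: "((nat \<Rightarrow> nat \<Rightarrow> nat) \<Rightarrow> nat \<Rightarrow> nat) \<Rightarrow> bool" where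
  "total_recursive f \<longleftrightarrow> recursive_functional (\<lambda>\<phi> n. Some (f \<phi> n))"

lemma total_recursive_comp:
  assumes "total_recursive f" "total_recursive g"
  shows "total_recursive (\<lambda>\<phi> n. f \<phi> (g \<phi> n))"
  using recursive_functional.comp[OF assms[unfolded total_recursive_def]]
  by (simp add: total_recursive_def)

lemma total_recursive_pair:
  assumes "total_recursive f" "total_recursive g"
  shows "total_recursive (\<lambda>\<phi> n. prod_encode (f \<phi> n, g \<phi> n))"
  using recursive_functional.pair[OF assms[unfolded total_recursive_def]]
  by (simp add: total_recursive_def)

lemma total_recursive_fst: "total_recursive (\<lambda>\<phi> n. fst (prod_decode n))"
  and total_recursive_snd: "total_recursive (\<lambda>\<phi> n. snd (prod_decode n))"
  and total_recursive_Suc: "total_recursive (\<lambda>\<phi> n. Suc n)"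
  and total_recursive_query: "total_recursive (\<lambda>\<phi> n. \<phi> i n)"
  unfolding total_recursive_def by (rule recursive_functional.intros)+

lemma total_recursive_const: "total_recursive (\<lambda>\<phi> n. k)"
proof (induction k)
  case 0
  show ?case unfolding total_recursive_def by (rule recursive_functional.zero)
next
  case (Suc k)
  show ?case by (rule total_recursive_comp[OF total_recursive_Suc Suc])
qed

lemma total_recursive_id: "total_recursive (\<lambda>\<phi> n. n)"
  using total_recursive_pair[OF total_recursive_fst total_recursive_snd] by simp

text \<open>Iteration whose step sees the parameter and the previous value but not the counter;
  addition, multiplication and powers are instances. The nested projections unpack the coding
  \<open>(a, (m, r))\<close> of \<open>prim_iter\<close>.\<close>

lemma total_recursive_prec:
  assumes "total_recursive f" "total_recursive (\<lambda>\<phi> n. g \<phi> (fst (prod_decode n)) (snd (prod_decode (snd (prod_decode n)))))"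
    and "total_recursive h" "total_recursive k"
  shows "total_recursive (\<lambda>\<phi> n. rec_nat (f \<phi> (h \<phi> n)) (\<lambda>_ r. g \<phi> (h \<phi> n) r) (k \<phi> n))"
proof -
  let ?g = "\<lambda>\<phi> n. g \<phi> (fst (prod_decode n)) (snd (prod_decode (snd (prod_decode n))))"
  have "prim_iter (\<lambda>n. Some (f \<phi> n)) (\<lambda>n. Some (?g \<phi> n)) a m =
      Some (rec_nat (f \<phi> a) (\<lambda>_ r. g \<phi> a r) m)" for \<phi> a m
    by (induction m) simp_all
  then have "total_recursive (\<lambda>\<phi> n. rec_nat (f \<phi> (fst (prod_decode n)))
      (\<lambda>_ r. g \<phi> (fst (prod_decode n)) r) (snd (prod_decode n)))"
    using recursive_functional.prec[OF assms(1,2)[unfolded total_recursive_def]]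
    by (simp add: total_recursive_def)
  from total_recursive_comp[OF this total_recursive_pair[OF assms(3,4)]]
  show ?thesis by simp
qed

lemma total_recursive_add:
  assumes "total_recursive f" "total_recursive g"
  shows "total_recursive (\<lambda>\<phi> n. f \<phi> n + g \<phi> n)"
proof -
  have "total_recursive (\<lambda>\<phi> n. rec_nat (f \<phi> n) (\<lambda>_ r. Suc r) (g \<phi> n))"
    by (rule total_recursive_prec[where f = "\<lambda>_ n. n" and g = "\<lambda>_ _ r. Suc r"])
      (intro assms total_recursive_id total_recursive_comp[OF total_recursive_Suc]
        total_recursive_comp[OF total_recursive_snd] total_recursive_snd)+
  moreover have "rec_nat a (\<lambda>_ r. Suc r) b = a + b" for a b by (induction b) auto
  ultimately show ?thesis by simp
qed

lemma total_recursive_mult: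
  assumes "total_recursive f" "total_recursive g"
  shows "total_recursive (\<lambda>\<phi> n. f \<phi> n * g \<phi> n)"
proof -
  have "total_recursive (\<lambda>\<phi> n. rec_nat 0 (\<lambda>_ r. f \<phi> n + r) (g \<phi> n))"
    by (rule total_recursive_prec[where f = "\<lambda>_ n. 0" and g = "\<lambda>_ a r. a + r"])
      (intro assms total_recursive_const total_recursive_add total_recursive_fst
        total_recursive_comp[OF total_recursive_snd] total_recursive_snd)+
  moreover have "rec_nat 0 (\<lambda>_ r. a + r) b = a * b" for a b :: nat by (induction b) auto
  ultimately show ?thesis by simp
qed

lemma total_recursive_power:
  assumes "total_recursive f" "total_recursive g"
  shows "total_recursive (\<lambda>\<phi> n. f \<phi> n ^ g \<phi> n)"
proof -
  have "total_recursive (\<lambda>\<phi> n. rec_nat 1 (\<lambda>_ r. f \<phi> n * r) (g \<phi> n))"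
    by (rule total_recursive_prec[where f = "\<lambda>_ n. 1" and g = "\<lambda>_ a r. a * r"])
      (intro assms total_recursive_const total_recursive_mult total_recursive_fst
        total_recursive_comp[OF total_recursive_snd] total_recursive_snd)+
  moreover have "rec_nat 1 (\<lambda>_ r. a * r) b = a ^ b" for a b :: nat by (induction b) auto
  ultimately show ?thesis by simp
qed

text \<open>This sum is all that the algorithm extracts from \<open>\<phi> 0\<close> and
  \<open>\<phi> 2\<close>. Codes dominate degrees, numerators and denominators, so one number
  controls both polynomials.\<close>

definition data_size :: "real \<Rightarrow> real \<Rightarrow> nat" where
  "data_size \<alpha> \<beta> = encode_rat_poly (min_poly \<alpha>) + encode_rat_poly (coordinate_poly \<alpha> \<beta>)"

text \<open>A code of \<open>C\<^sub>0\<close> at precision \<open>n + l\<close> is, unchanged, a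
  code of \<open>2 ^ l * C\<^sub>0\<close> at precision \<open>n\<close>, so a single query of
  \<open>\<phi> 4\<close> at a shifted argument gives the output.\<close>

lemma effectively_computable_scaled:
  assumes "total_recursive (\<lambda>\<phi> n. L n)"
  shows "effectively_computable (\<lambda>\<alpha> \<beta> \<mu> C\<^sub>0. 2 ^ L (data_size \<alpha> \<beta>) * C\<^sub>0)"
proof -
  let ?F = "\<lambda>\<phi> n. Some (\<phi> 4 (n + L (\<phi> 0 n + \<phi> 2 n)))"
  have "total_recursive (\<lambda>\<phi> n. \<phi> 4 (n + L (\<phi> 0 n + \<phi> 2 n)))"
    by (intro total_recursive_comp[OF total_recursive_query] total_recursive_add
        total_recursive_id total_recursive_comp[OF assms] total_recursive_query)
  then have "recursive_functional ?F" by (simp add: total_recursive_def)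
  moreover have "\<forall>n. \<exists>c. ?F \<phi> n = Some c \<and> approximates c n (2 ^ L (data_size \<alpha> \<beta>) * C\<^sub>0)"
    if adm: "admissible d \<alpha> \<beta> \<mu> C\<^sub>0" and name: "data_name \<phi> \<alpha> \<beta> \<mu> C\<^sub>0" for d \<alpha> \<beta> \<mu> C\<^sub>0 \<phi>
  proof
    fix n
    from name obtain q where q: "degree q < degree (min_poly \<alpha>)" "rpoly q \<alpha> = \<beta>"
        "\<forall>n. \<phi> 2 n = encode_rat_poly q"
      unfolding data_name_def by blast
    have "coordinate_poly \<alpha> \<beta> = q" unfolding coordinate_poly_def
      using q adm by (intro the1_equality rat_adjoin_imp_rpoly) (auto simp: admissible_def algebraic_of_degree_def)
    then have N: "\<phi> 0 n + \<phi> 2 n = data_size \<alpha> \<beta>"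
      using name q by (simp add: data_name_def data_size_def)
    define l where "l = L (data_size \<alpha> \<beta>)"
    have "approximates (\<phi> 4 (n + l)) (n + l) C\<^sub>0"
      using name by (simp add: data_name_def real_name_def)
    then have "2 ^ l * \<bar>C\<^sub>0 - real_of_int (int_decode (\<phi> 4 (n + l))) / 2 ^ (n + l)\<bar> \<le> 2 ^ l * (1 / 2 ^ (n + l))"
      unfolding approximates_def by (rule mult_left_mono) simp
    moreover have "2 ^ l * \<bar>C\<^sub>0 - real_of_int (int_decode (\<phi> 4 (n + l))) / 2 ^ (n + l)\<bar> =
        \<bar>2 ^ l * (C\<^sub>0 - real_of_int (int_decode (\<phi> 4 (n + l))) / 2 ^ (n + l))\<bar>"
      by (simp add: abs_mult)
    ultimately have "approximates (\<phi> 4 (n + l)) n (2 ^ l * C\<^sub>0)"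
      unfolding approximates_def by (simp add: right_diff_distrib power_add)
    then show "\<exists>c. ?F \<phi> n = Some c \<and> approximates c n (2 ^ L (data_size \<alpha> \<beta>) * C\<^sub>0)"
      by (simp add: N l_def)
  qed
  ultimately show ?thesis unfolding effectively_computable_def by (intro exI[of _ ?F]) blast
qed

section \<open>Values of integer polynomials at rational points\<close>

abbreviation ipoly :: "int poly \<Rightarrow> real \<Rightarrow> real" where
  "ipoly P x \<equiv> poly (map_poly of_int P) x"

lemmas of_int_poly_hom = of_int_poly_add of_int_poly_diff of_int_poly_mult of_int_poly_smult of_int_poly_pderiv

lemma poly_mean_value:
  fixes f :: "real poly"
  shows "\<exists>z. poly f b - poly f a = (b - a) * poly (pderiv f) z \<and> min a b \<le> z \<and> z \<le> max a b"
proof (cases a b rule: linorder_cases)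
  case less
  with poly_MVT[of a b f] show ?thesis by (auto intro: less_imp_le)
next
  case greater
  with poly_MVT[of b a f] show ?thesis
    by (metis less_imp_le max.absorb1 min.absorb2 minus_diff_eq mult_minus_left)
qed auto

section \<open>Homogeneous forms and heights\<close>

definition homogenize :: "int poly \<Rightarrow> nat \<Rightarrow> int \<Rightarrow> int \<Rightarrow> int" where
  "homogenize P n x y = (\<Sum>i\<le>n. coeff P i * x ^ i * y ^ (n - i))"

lemma homogenize:
  assumes "degree P \<le> n" "y \<noteq> 0"
  shows "of_int (homogenize P n x y) = of_int y ^ n * ipoly P (of_int x / of_int y)"
proof -
  have "ipoly P (of_int x / of_int y) = (\<Sum>i\<le>n. of_int (coeff P i) * (of_int x / of_int y) ^ i)"
    unfolding poly_altdef using assms(1)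
    by (intro sum.mono_neutral_cong_left) (auto simp: coeff_map_poly degree_map_poly coeff_eq_0)
  moreover have "real_of_int y ^ (n - i) = of_int y ^ n / of_int y ^ i" if "i \<le> n" for i
    using that assms(2) by (simp add: power_diff)
  ultimately show ?thesis
    by (simp add: homogenize_def sum_distrib_left power_divide mult_ac)
qed

text \<open>Homogenised to degree \<open>2 * e - 1\<close> at \<open>(x, y)\<close>, the Bezout
  identity expresses \<open>r * (x ^ j * y ^ (2 * e - 1 - j))\<close> as an integer combination of
  the two values divisible by \<open>g\<close>.\<close>

lemma common_factor_divides:
  fixes P Q U V :: "int poly"
  assumes deg: "degree P \<le> e" "degree Q \<le> e" "degree U < e" "degree V < e"
    and eq: "U * P + V * Q = monom r j" "j \<le> 2 * e - 1" and "y \<noteq> 0"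
    and g: "g dvd homogenize P e x y" "g dvd homogenize Q e x y"
  shows "g dvd r * (x ^ j * y ^ (2 * e - 1 - j))"
proof -
  let ?t = "of_int x / of_int y :: real"
  have e: "2 * e - 1 = (e - 1) + e" "degree U \<le> e - 1" "degree V \<le> e - 1" using deg by auto
  have "of_int (homogenize U (e - 1) x y * homogenize P e x y + homogenize V (e - 1) x y * homogenize Q e x y)
     = of_int y ^ (2 * e - 1) * (ipoly U ?t * ipoly P ?t + ipoly V ?t * ipoly Q ?t)"
    unfolding e(1) power_add using e(2,3) deg(1,2) \<open>y \<noteq> 0\<close>
    by (simp add: homogenize ring_distribs mult_ac)
  also have "ipoly U ?t * ipoly P ?t + ipoly V ?t * ipoly Q ?t = of_int r * ?t ^ j"
    using arg_cong[OF eq(1), of "\<lambda>F. ipoly F ?t"]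
    by (simp add: of_int_poly_hom map_poly_monom poly_monom)
  also have "of_int y ^ (2 * e - 1) * (of_int r * ?t ^ j) =
      of_int (r * (x ^ j * y ^ (2 * e - 1 - j)))"
  proof -
    have "real_of_int y ^ (2 * e - 1 - j) = of_int y ^ (2 * e - 1) / of_int y ^ j"
      using eq(2) \<open>y \<noteq> 0\<close> by (subst power_diff) auto
    then show ?thesis by (simp add: power_divide)
  qed
  finally have "homogenize U (e - 1) x y * homogenize P e x y + homogenize V (e - 1) x y * homogenize Q e x y
      = r * (x ^ j * y ^ (2 * e - 1 - j))" by (simp only: of_int_eq_iff)
  then show ?thesis using g by (metis dvd_add dvd_mult)
qed

lemma height_pos: "y \<noteq> 0 \<Longrightarrow> 1 \<le> height x y"
  by (auto simp: height_def)

lemma height_le: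
  assumes "y \<noteq> 0" "\<bar>of_int x / of_int y\<bar> \<le> X" "1 \<le> X"
  shows "of_int (height x y) \<le> X * \<bar>of_int y :: real\<bar>"
proof -
  have "\<bar>of_int x :: real\<bar> \<le> X * \<bar>of_int y\<bar>" using assms by (simp add: abs_divide divide_le_eq)
  moreover have "\<bar>of_int y :: real\<bar> \<le> X * \<bar>of_int y\<bar>" using assms(3) by (simp add: mult_le_cancel_right1)
  ultimately show ?thesis by (simp add: height_def)
qed

text \<open>The homogenised values of \<open>P\<close> and \<open>Q\<close> are
  \<open>x\<^sub>2 * g\<close> and \<open>y\<^sub>2 * g\<close>. The two Bezout identities together
  force \<open>g\<close> to divide \<open>r\<^sub>1 * r\<^sub>2\<close>, so little cancels; the
  first one also keeps \<open>P\<close> and \<open>Q\<close> from being small at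
  \<open>\<xi>\<close> simultaneously.\<close>

lemma height_rational_function_value:
  fixes P Q U\<^sub>1 V\<^sub>1 U\<^sub>2 V\<^sub>2 :: "int poly" and X K :: real
  assumes deg: "degree P \<le> e" "degree Q \<le> e" "degree U\<^sub>1 < e" "degree V\<^sub>1 < e" "degree U\<^sub>2 < e" "degree V\<^sub>2 < e"
    and r: "r\<^sub>1 \<noteq> 0" "r\<^sub>2 \<noteq> 0" "\<bar>of_int r\<^sub>1\<bar> \<le> K" "\<bar>of_int r\<^sub>2\<bar> \<le> K"
    and eq: "U\<^sub>1 * P + V\<^sub>1 * Q = monom r\<^sub>1 0" "U\<^sub>2 * P + V\<^sub>2 * Q = monom r\<^sub>2 (2 * e - 1)"
    and x: "coprime x\<^sub>1 y\<^sub>1" "y\<^sub>1 \<noteq> 0" "coprime x\<^sub>2 y\<^sub>2" "y\<^sub>2 \<noteq> 0"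
    and \<xi>: "\<xi> = of_int x\<^sub>1 / of_int y\<^sub>1" "\<bar>\<xi>\<bar> \<le> X" "1 \<le> X" "X \<le> K"
    and UV: "\<bar>ipoly U\<^sub>1 \<xi>\<bar> \<le> K" "\<bar>ipoly V\<^sub>1 \<xi>\<bar> \<le> K"
    and zero: "ipoly P \<xi> * of_int y\<^sub>2 = of_int x\<^sub>2 * ipoly Q \<xi>"
  shows "of_int (height x\<^sub>1 y\<^sub>1) ^ e \<le> 2 * K ^ (e + 3) * of_int (height x\<^sub>2 y\<^sub>2)"
proof -
  let ?p = "homogenize P e x\<^sub>1 y\<^sub>1" and ?q = "homogenize Q e x\<^sub>1 y\<^sub>1" and ?H = "height x\<^sub>2 y\<^sub>2"
  have K: "1 \<le> K" using \<xi> by simp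
  have pq: "of_int ?p = of_int y\<^sub>1 ^ e * ipoly P \<xi>" "of_int ?q = of_int y\<^sub>1 ^ e * ipoly Q \<xi>"
    using homogenize deg x \<xi> by auto
  have "real_of_int (?p * y\<^sub>2) = of_int (x\<^sub>2 * ?q)" using zero pq by (simp add: mult.assoc mult.left_commute)
  then have *: "?p * y\<^sub>2 = x\<^sub>2 * ?q" by (simp only: of_int_eq_iff)
  then have "y\<^sub>2 dvd ?q" using x(3)
    by (metis coprime_commute coprime_dvd_mult_right_iff dvd_triv_right)
  then obtain g where g: "?q = y\<^sub>2 * g" by (elim dvdE)
  with * x(4) have g': "?p = x\<^sub>2 * g" by (simp add: mult.left_commute)
  have "g dvd r\<^sub>1 * (x\<^sub>1 ^ 0 * y\<^sub>1 ^ (2 * e - 1 - 0))"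
    by (rule common_factor_divides[of P e Q U\<^sub>1 V\<^sub>1]) (use deg eq x g g' in auto)
  moreover have "g dvd r\<^sub>2 * (x\<^sub>1 ^ (2 * e - 1) * y\<^sub>1 ^ (2 * e - 1 - (2 * e - 1)))"
    by (rule common_factor_divides[of P e Q U\<^sub>2 V\<^sub>2]) (use deg eq x g g' in auto)
  ultimately have "g dvd r\<^sub>2 * (r\<^sub>1 * y\<^sub>1 ^ (2 * e - 1))" "g dvd r\<^sub>1 * (r\<^sub>2 * x\<^sub>1 ^ (2 * e - 1))"
    by (simp_all add: dvd_mult)
  then have "g dvd r\<^sub>1 * r\<^sub>2 * y\<^sub>1 ^ (2 * e - 1)" "g dvd r\<^sub>1 * r\<^sub>2 * x\<^sub>1 ^ (2 * e - 1)"
    by (simp_all only: mult_ac)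
  then have "g dvd gcd (r\<^sub>1 * r\<^sub>2 * y\<^sub>1 ^ (2 * e - 1)) (r\<^sub>1 * r\<^sub>2 * x\<^sub>1 ^ (2 * e - 1))" by simp
  moreover have "gcd (y\<^sub>1 ^ (2 * e - 1)) (x\<^sub>1 ^ (2 * e - 1)) = 1"
    using x(1) by (simp add: coprime_iff_gcd_eq_1[symmetric] coprime_commute)
  ultimately have "g dvd r\<^sub>1 * r\<^sub>2" unfolding gcd_mult_left by simp
  then have "\<bar>g\<bar> \<le> \<bar>r\<^sub>1 * r\<^sub>2\<bar>" using r by (intro dvd_imp_le_int) auto
  then have "real_of_int \<bar>g\<bar> \<le> of_int \<bar>r\<^sub>1 * r\<^sub>2\<bar>" by (simp only: of_int_le_iff)
  also have "\<dots> \<le> K * K" using r K by (simp add: abs_mult mult_mono)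
  finally have gK: "\<bar>real_of_int g\<bar> \<le> K * K" by simp
  \<comment> \<open>The first identity bounds
    \<open>\<bar>ipoly P \<xi>\<bar> + \<bar>ipoly Q \<xi>\<bar>\<close> from below by
    \<open>1 / K\<close>.\<close>
  have "of_int r\<^sub>1 = ipoly U\<^sub>1 \<xi> * ipoly P \<xi> + ipoly V\<^sub>1 \<xi> * ipoly Q \<xi>"
    using arg_cong[OF eq(1), of "\<lambda>F. ipoly F \<xi>"]
    by (simp add: of_int_poly_hom map_poly_monom poly_monom)
  moreover have "(1::real) \<le> \<bar>of_int r\<^sub>1\<bar>" using r(1) by linarith
  ultimately have "1 \<le> \<bar>ipoly U\<^sub>1 \<xi>\<bar> * \<bar>ipoly P \<xi>\<bar> + \<bar>ipoly V\<^sub>1 \<xi>\<bar> * \<bar>ipoly Q \<xi>\<bar>"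
    using abs_triangle_ineq[of "ipoly U\<^sub>1 \<xi> * ipoly P \<xi>" "ipoly V\<^sub>1 \<xi> * ipoly Q \<xi>"]
    unfolding abs_mult by linarith
  also have "\<dots> \<le> K * \<bar>ipoly P \<xi>\<bar> + K * \<bar>ipoly Q \<xi>\<bar>"
    by (intro add_mono mult_right_mono UV) auto
  finally have "\<bar>of_int y\<^sub>1\<bar> ^ e * 1 \<le> \<bar>of_int y\<^sub>1\<bar> ^ e * (K * \<bar>ipoly P \<xi>\<bar> + K * \<bar>ipoly Q \<xi>\<bar>)"
    by (rule mult_left_mono) simp
  also have "\<dots> = K * \<bar>of_int ?p\<bar> + K * \<bar>of_int ?q\<bar>"
    unfolding pq abs_mult power_abs by (simp only: distrib_left mult_ac)
  also have "\<dots> = K * \<bar>of_int g\<bar> * (\<bar>of_int x\<^sub>2\<bar> + \<bar>of_int y\<^sub>2\<bar>)"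
    unfolding g g' of_int_mult abs_mult by (simp only: distrib_left mult_ac)
  also have "\<dots> \<le> K * (K * K) * (2 * of_int ?H)"
    by (intro mult_mono gK) (use K in \<open>auto simp: height_def\<close>)
  finally have y: "\<bar>of_int y\<^sub>1\<bar> ^ e \<le> 2 * K ^ 3 * of_int ?H" by (simp add: power3_eq_cube)
  \<comment> \<open>As \<open>\<xi>\<close> is bounded, the denominator is comparable to the height;
    the factor \<open>K ^ e\<close> of the final bound comes from here.\<close>
  have "of_int (height x\<^sub>1 y\<^sub>1) \<le> K * \<bar>of_int y\<^sub>1 :: real\<bar>"
    using x \<xi> K by (intro height_le) auto
  then have "of_int (height x\<^sub>1 y\<^sub>1) ^ e \<le> (K * \<bar>of_int y\<^sub>1 :: real\<bar>) ^ e"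
    using height_pos[OF x(2), of x\<^sub>1] by (intro power_mono) auto
  also have "\<dots> \<le> K ^ e * (2 * K ^ 3 * of_int ?H)"
    unfolding power_mult_distrib using y K by (intro mult_left_mono) auto
  finally show ?thesis by (simp add: power_add mult_ac)
qed

text \<open>A nonzero integer has absolute value at least 1. Both errors are measured by the smaller
  height, since the second height is at least the first. The number \<open>\<delta>\<close> will be
  \<open>d / 2\<close>, which replaces the exponent \<open>\<mu> - e\<close> by one that does not
  mention \<open>e\<close>.\<close>

lemma gap_or_vanishing:
  fixes P Q :: "int poly" and K C\<^sub>0 \<mu> :: real
  assumes deg: "degree P \<le> e" "degree Q \<le> e"
    and K: "1 \<le> K" "\<bar>ipoly Q \<xi>\<bar> \<le> K" "\<bar>ipoly P \<xi> - \<beta> * ipoly Q \<xi>\<bar> \<le> K * \<bar>\<alpha> - \<xi>\<bar>"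
    and y: "y\<^sub>1 \<noteq> 0" "y\<^sub>2 \<noteq> 0" and \<xi>: "\<xi> = of_int x\<^sub>1 / of_int y\<^sub>1"
    and H: "height x\<^sub>1 y\<^sub>1 \<le> height x\<^sub>2 y\<^sub>2" and C: "0 < C\<^sub>0" "0 < \<mu>" "real e \<le> \<delta>"
    and appr: "\<bar>\<alpha> - \<xi>\<bar> < C\<^sub>0 / of_int (height x\<^sub>1 y\<^sub>1) powr \<mu>"
      "\<bar>\<beta> - of_int x\<^sub>2 / of_int y\<^sub>2\<bar> < C\<^sub>0 / of_int (height x\<^sub>2 y\<^sub>2) powr \<mu>"
    and nz: "ipoly P \<xi> * of_int y\<^sub>2 \<noteq> of_int x\<^sub>2 * ipoly Q \<xi>"
  shows "of_int (height x\<^sub>2 y\<^sub>2) > inverse (2 * K * C\<^sub>0) * of_int (height x\<^sub>1 y\<^sub>1) powr (\<mu> - \<delta>)"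
proof -
  define h k where "h = real_of_int (height x\<^sub>1 y\<^sub>1)" and "k = real_of_int (height x\<^sub>2 y\<^sub>2)"
  have h: "1 \<le> h" "h \<le> k" using height_pos[OF y(1), of x\<^sub>1] H by (auto simp: h_def k_def)
  define \<eta> where "\<eta> = real_of_int x\<^sub>2 / of_int y\<^sub>2"
  let ?p = "homogenize P e x\<^sub>1 y\<^sub>1" and ?q = "homogenize Q e x\<^sub>1 y\<^sub>1"
  have pq: "of_int ?p = of_int y\<^sub>1 ^ e * ipoly P \<xi>" "of_int ?q = of_int y\<^sub>1 ^ e * ipoly Q \<xi>"
    using homogenize deg y \<xi> by auto
  have eq: "of_int (?p * y\<^sub>2 - x\<^sub>2 * ?q) = of_int y\<^sub>1 ^ e * of_int y\<^sub>2 * (ipoly P \<xi> - \<eta> * ipoly Q \<xi>)"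
    using pq y by (simp add: \<eta>_def algebra_simps)
  have "ipoly P \<xi> - \<eta> * ipoly Q \<xi> \<noteq> 0" using nz y by (auto simp: \<eta>_def field_simps)
  then have "real_of_int (?p * y\<^sub>2 - x\<^sub>2 * ?q) \<noteq> 0" unfolding eq using y by simp
  then have "1 \<le> \<bar>?p * y\<^sub>2 - x\<^sub>2 * ?q\<bar>" by linarith
  then have "real_of_int 1 \<le> of_int \<bar>?p * y\<^sub>2 - x\<^sub>2 * ?q\<bar>" by (simp only: of_int_le_iff)
  then have "(1::real) \<le> \<bar>of_int (?p * y\<^sub>2 - x\<^sub>2 * ?q)\<bar>" by (simp only: of_int_abs of_int_1)
  also have "\<dots> = \<bar>of_int y\<^sub>1\<bar> ^ e * \<bar>of_int y\<^sub>2\<bar> * \<bar>ipoly P \<xi> - \<eta> * ipoly Q \<xi>\<bar>"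
    unfolding eq by (simp add: abs_mult power_abs)
  also have "\<dots> \<le> h ^ e * k * \<bar>ipoly P \<xi> - \<eta> * ipoly Q \<xi>\<bar>"
    using h by (intro mult_mono power_mono) (auto simp: h_def k_def height_def)
  finally have 1: "1 \<le> h ^ e * k * \<bar>ipoly P \<xi> - \<eta> * ipoly Q \<xi>\<bar>" .
  have "ipoly P \<xi> - \<eta> * ipoly Q \<xi> = (ipoly P \<xi> - \<beta> * ipoly Q \<xi>) + (\<beta> - \<eta>) * ipoly Q \<xi>"
    by (simp add: algebra_simps)
  then have "\<bar>ipoly P \<xi> - \<eta> * ipoly Q \<xi>\<bar> \<le> K * \<bar>\<alpha> - \<xi>\<bar> + \<bar>\<beta> - \<eta>\<bar> * \<bar>ipoly Q \<xi>\<bar>"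
    using K(3) abs_triangle_ineq[of "ipoly P \<xi> - \<beta> * ipoly Q \<xi>" "(\<beta> - \<eta>) * ipoly Q \<xi>"]
    unfolding abs_mult by linarith
  also have "\<dots> \<le> K * \<bar>\<alpha> - \<xi>\<bar> + \<bar>\<beta> - \<eta>\<bar> * K"
    using K by (intro add_left_mono mult_left_mono) auto
  also have "\<bar>\<beta> - \<eta>\<bar> \<le> C\<^sub>0 / h powr \<mu>"
  proof -
    have "\<bar>\<beta> - \<eta>\<bar> \<le> C\<^sub>0 / k powr \<mu>" using appr(2) by (simp add: \<eta>_def k_def)
    also have "\<dots> \<le> C\<^sub>0 / h powr \<mu>" using h C by (intro divide_left_mono powr_mono2) auto
    finally show ?thesis .
  qed
  also have "\<bar>\<alpha> - \<xi>\<bar> < C\<^sub>0 / h powr \<mu>" using appr(1) by (simp add: h_def)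
  finally have "\<bar>ipoly P \<xi> - \<eta> * ipoly Q \<xi>\<bar> < 2 * K * (C\<^sub>0 / h powr \<mu>)" using K by (simp add: mult_ac)
  then have "h ^ e * k * \<bar>ipoly P \<xi> - \<eta> * ipoly Q \<xi>\<bar> < h ^ e * k * (2 * K * (C\<^sub>0 / h powr \<mu>))"
    using h by (intro mult_strict_left_mono) auto
  with 1 have "1 < h ^ e * k * (2 * K * (C\<^sub>0 / h powr \<mu>))" by linarith
  also have "\<dots> = k * (2 * K * C\<^sub>0) / (h powr \<mu> / h ^ e)" using h by (simp add: mult_ac)
  also have "h powr \<mu> / h ^ e = h powr (\<mu> - e)" using h by (simp add: powr_diff powr_realpow)
  finally have "h powr (\<mu> - e) < k * (2 * K * C\<^sub>0)"
    using h by (subst (asm) pos_less_divide_eq) simp_all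
  moreover have "h powr (\<mu> - \<delta>) \<le> h powr (\<mu> - e)" using h C by (intro powr_mono) auto
  ultimately have "h powr (\<mu> - \<delta>) < k * (2 * K * C\<^sub>0)" by linarith
  moreover have "0 < 2 * K * C\<^sub>0" using K C by simp
  ultimately have "h powr (\<mu> - \<delta>) / (2 * K * C\<^sub>0) < k" by (simp only: pos_divide_less_eq)
  then show ?thesis unfolding divide_inverse h_def k_def by (simp only: mult.commute)
qed

section \<open>Liouville's inequality and behaviour near a zero\<close>

lemma liouville:
  fixes F :: "int poly"
  assumes "degree F \<le> d" "y \<noteq> 0" "ipoly F (of_int x / of_int y) \<noteq> 0"
    and "\<bar>ipoly F (of_int x / of_int y)\<bar> \<le> K * \<bar>\<alpha> - of_int x / of_int y\<bar>"
  shows "1 \<le> of_int (height x y) ^ d * (K * \<bar>\<alpha> - of_int x / of_int y\<bar>)"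
proof -
  let ?h = "homogenize F d x y"
  have eq: "of_int ?h = of_int y ^ d * ipoly F (of_int x / of_int y)"
    using homogenize assms by auto
  then have "?h \<noteq> 0" using assms(2,3) by (metis mult_eq_0_iff of_int_0 of_int_eq_0_iff power_not_zero)
  then have "(1::real) \<le> \<bar>of_int ?h\<bar>" by linarith
  also have "\<dots> = \<bar>of_int y\<bar> ^ d * \<bar>ipoly F (of_int x / of_int y)\<bar>"
    unfolding eq by (simp add: abs_mult power_abs)
  also have "\<dots> \<le> of_int (height x y) ^ d * (K * \<bar>\<alpha> - of_int x / of_int y\<bar>)"
    using assms(4) height_pos[OF assms(2), of x]
    by (intro mult_mono power_mono) (auto simp: height_def)
  finally show ?thesis .
qed

text \<open>A quantitative form of having a simple zero: by the bound on the second derivative, the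
  first derivative between \<open>\<alpha>\<close> and \<open>\<xi>\<close> differs from its value
  at \<open>\<alpha>\<close> by at most \<open>1 / (2 * K)\<close>, so it stays at least
  \<open>1 / (2 * K)\<close> in size and the mean value theorem can be inverted.\<close>

lemma distance_le_poly_value:
  fixes f :: "real poly"
  assumes "poly f \<alpha> = 0" "1 / K \<le> \<bar>poly (pderiv f) \<alpha>\<bar>" "1 \<le> K"
    and bd: "\<And>t. \<bar>t\<bar> \<le> X \<Longrightarrow> \<bar>poly (pderiv (pderiv f)) t\<bar> \<le> K"
    and "\<bar>\<alpha>\<bar> \<le> X" "\<bar>\<xi>\<bar> \<le> X" "\<bar>\<alpha> - \<xi>\<bar> \<le> 1 / (2 * K\<^sup>2)"
  shows "\<bar>\<alpha> - \<xi>\<bar> \<le> 2 * K * \<bar>poly f \<xi>\<bar>"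
proof -
  obtain z where z: "poly f \<xi> - poly f \<alpha> = (\<xi> - \<alpha>) * poly (pderiv f) z" "min \<alpha> \<xi> \<le> z" "z \<le> max \<alpha> \<xi>"
    using poly_mean_value by blast
  obtain w where w: "poly (pderiv f) z - poly (pderiv f) \<alpha> = (z - \<alpha>) * poly (pderiv (pderiv f)) w"
      "min \<alpha> z \<le> w" "w \<le> max \<alpha> z"
    using poly_mean_value by blast
  have "\<bar>w\<bar> \<le> X" using z w assms(5,6) by linarith
  have "\<bar>(z - \<alpha>) * poly (pderiv (pderiv f)) w\<bar> \<le> 1 / (2 * K\<^sup>2) * K"
    unfolding abs_mult using bd[OF \<open>\<bar>w\<bar> \<le> X\<close>] z assms(3,7) by (intro mult_mono) auto
  also have "\<dots> = 1 / (2 * K)" using assms(3) by (simp add: power2_eq_square)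
  finally have "\<bar>poly (pderiv f) z - poly (pderiv f) \<alpha>\<bar> \<le> 1 / (2 * K)" using w by simp
  moreover have "1 / K = 1 / (2 * K) + 1 / (2 * K)" using assms(3) by (simp add: field_simps)
  ultimately have "1 / (2 * K) \<le> \<bar>poly (pderiv f) z\<bar>" using assms(2) by linarith
  then have "\<bar>\<alpha> - \<xi>\<bar> * (1 / (2 * K)) \<le> \<bar>\<alpha> - \<xi>\<bar> * \<bar>poly (pderiv f) z\<bar>" by (rule mult_left_mono) simp
  also have "\<dots> = \<bar>poly f \<xi>\<bar>" using z(1) assms(1) by (simp add: abs_mult abs_minus_commute)
  finally show ?thesis using assms(3) by (simp add: field_simps)
qed

lemma poly_difference_bound:
  fixes f :: "real poly"
  assumes "poly f \<alpha> = 0" "\<And>t. \<bar>t\<bar> \<le> X \<Longrightarrow> \<bar>poly (pderiv f) t\<bar> \<le> K" "\<bar>\<alpha>\<bar> \<le> X" "\<bar>\<xi>\<bar> \<le> X"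
  shows "\<bar>poly f \<xi>\<bar> \<le> K * \<bar>\<alpha> - \<xi>\<bar>"
proof -
  obtain z where z: "poly f \<xi> - poly f \<alpha> = (\<xi> - \<alpha>) * poly (pderiv f) z" "min \<alpha> \<xi> \<le> z" "z \<le> max \<alpha> \<xi>"
    using poly_mean_value by blast
  have "\<bar>z\<bar> \<le> X" using z assms(3,4) by linarith
  then have "\<bar>\<xi> - \<alpha>\<bar> * \<bar>poly (pderiv f) z\<bar> \<le> \<bar>\<xi> - \<alpha>\<bar> * K" using assms(2) by (intro mult_left_mono) auto
  then show ?thesis using z(1) assms(1) by (simp add: abs_mult abs_minus_commute mult.commute)
qed

text \<open>Isolates the estimates from the construction of the polynomials: \<open>K\<close> bounds
  all the polynomial data and \<open>S\<close> absorbs every constant. If the vanishing holds with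
  \<open>e \<ge> 2\<close>, the second height is at least of the order of the square of the first,
  so \<open>\<bar>\<beta> - \<eta>\<bar>\<close> and with it
  \<open>\<bar>\<alpha> - \<xi>\<bar>\<close> has order at most \<open>h powr (- 2 * \<mu>)\<close>,
  whereas Liouville requires at least order \<open>h powr (- d)\<close>.\<close>

lemma gap_or_degree_one:
  fixes P Q F U\<^sub>1 V\<^sub>1 U\<^sub>2 V\<^sub>2 :: "int poly" and K X S C\<^sub>0 \<mu> \<alpha> \<beta> :: real and d e :: nat
  defines "\<psi> \<equiv> smult \<beta> (map_poly of_int Q) - map_poly of_int P"
  assumes e: "1 \<le> e" "2 * e \<le> d"
    and deg: "degree P \<le> e" "degree Q \<le> e" "degree F \<le> d"
      "degree U\<^sub>1 < e" "degree V\<^sub>1 < e" "degree U\<^sub>2 < e" "degree V\<^sub>2 < e"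
    and r: "r\<^sub>1 \<noteq> 0" "r\<^sub>2 \<noteq> 0" "\<bar>of_int r\<^sub>1\<bar> \<le> K" "\<bar>of_int r\<^sub>2\<bar> \<le> K"
    and eq: "U\<^sub>1 * P + V\<^sub>1 * Q = monom r\<^sub>1 0" "U\<^sub>2 * P + V\<^sub>2 * Q = monom r\<^sub>2 (2 * e - 1)"
    and \<alpha>: "ipoly P \<alpha> = \<beta> * ipoly Q \<alpha>" "ipoly F \<alpha> = 0" "\<bar>\<alpha>\<bar> + 1 \<le> X" "X \<le> K"
    and F: "\<And>x y. y \<noteq> 0 \<Longrightarrow> ipoly F (of_int x / of_int y) \<noteq> 0"
    and bd: "\<And>t. \<bar>t\<bar> \<le> X \<Longrightarrow> \<bar>ipoly Q t\<bar> \<le> K" "\<And>t. \<bar>t\<bar> \<le> X \<Longrightarrow> \<bar>ipoly U\<^sub>1 t\<bar> \<le> K"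
      "\<And>t. \<bar>t\<bar> \<le> X \<Longrightarrow> \<bar>ipoly V\<^sub>1 t\<bar> \<le> K" "\<And>t. \<bar>t\<bar> \<le> X \<Longrightarrow> \<bar>ipoly (pderiv F) t\<bar> \<le> K"
      "\<And>t. \<bar>t\<bar> \<le> X \<Longrightarrow> \<bar>poly (pderiv \<psi>) t\<bar> \<le> K" "\<And>t. \<bar>t\<bar> \<le> X \<Longrightarrow> \<bar>poly (pderiv (pderiv \<psi>)) t\<bar> \<le> K"
    and \<psi>: "1 / K \<le> \<bar>poly (pderiv \<psi>) \<alpha>\<bar>"
    and \<mu>: "real d / 2 + 1 < \<mu>" "\<mu> < real d" "0 < C\<^sub>0"
    and S: "2 * K ^ 3 * (2 * K ^ (d + 3)) ^ d \<le> S"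
    and x: "coprime x\<^sub>1 y\<^sub>1" "y\<^sub>1 \<noteq> 0" "coprime x\<^sub>2 y\<^sub>2" "y\<^sub>2 \<noteq> 0"
    and H: "height x\<^sub>1 y\<^sub>1 \<le> height x\<^sub>2 y\<^sub>2" "S * C\<^sub>0 \<le> of_int (height x\<^sub>1 y\<^sub>1)"
    and appr: "\<bar>\<alpha> - of_int x\<^sub>1 / of_int y\<^sub>1\<bar> < C\<^sub>0 / of_int (height x\<^sub>1 y\<^sub>1) powr \<mu>"
      "\<bar>\<beta> - of_int x\<^sub>2 / of_int y\<^sub>2\<bar> < C\<^sub>0 / of_int (height x\<^sub>2 y\<^sub>2) powr \<mu>"
  shows "of_int (height x\<^sub>2 y\<^sub>2) > inverse (S * C\<^sub>0) * of_int (height x\<^sub>1 y\<^sub>1) powr (\<mu> - real d / 2) \<or>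
    e = 1 \<and> ipoly P (of_int x\<^sub>1 / of_int y\<^sub>1) * of_int y\<^sub>2 = of_int x\<^sub>2 * ipoly Q (of_int x\<^sub>1 / of_int y\<^sub>1)"
proof -
  define \<xi> \<eta> where "\<xi> = real_of_int x\<^sub>1 / of_int y\<^sub>1" and "\<eta> = real_of_int x\<^sub>2 / of_int y\<^sub>2"
  define h k where "h = real_of_int (height x\<^sub>1 y\<^sub>1)" and "k = real_of_int (height x\<^sub>2 y\<^sub>2)"
  define M where "M = 2 * K ^ (d + 3)"
  have h: "1 \<le> h" "h \<le> k" using height_pos[OF x(2), of x\<^sub>1] H by (auto simp: h_def k_def)
  have K: "1 \<le> K" using \<alpha>(3,4) by linarith
  have M: "1 \<le> M" using one_le_power[OF K, of "d + 3"] by (simp add: M_def)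
  have "2 * K ^ 3 * 1 \<le> 2 * K ^ 3 * M ^ d" using one_le_power[OF M] K by (intro mult_left_mono) auto
  then have S3: "2 * K ^ 3 \<le> S" using S by (simp add: M_def)
  have "K ^ 2 \<le> K ^ 3" using K by (intro power_increasing) auto
  moreover have "K ^ 1 \<le> K ^ 3" using K by (intro power_increasing) auto
  ultimately have S2: "2 * K\<^sup>2 \<le> S" "2 * K \<le> S" using S3 by auto
  have Spos: "0 < S" using S2 K by linarith
  \<comment> \<open>The exponent \<open>\<mu>\<close> exceeds 1, so the lower bound on the height
    brings \<open>\<xi>\<close> within \<open>1 / S\<close> of \<open>\<alpha>\<close>; this is
    close enough for \<open>distance_le_poly_value\<close> and keeps \<open>\<xi>\<close> in the
    range where the bounds \<open>K\<close> hold.\<close>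
  have "h powr 1 \<le> h powr \<mu>" using h \<mu> by (intro powr_mono) auto
  then have "C\<^sub>0 / h powr \<mu> \<le> C\<^sub>0 / h" using h \<mu> by (intro divide_left_mono) auto
  also have "\<dots> \<le> 1 / S" using H(2) h Spos by (simp add: h_def field_simps)
  finally have near: "\<bar>\<alpha> - \<xi>\<bar> \<le> 1 / S" using appr(1) by (simp add: \<xi>_def h_def)
  also have "1 / S \<le> 1 / (2 * K\<^sup>2)" using S2 K by (intro divide_left_mono) auto
  finally have near2: "\<bar>\<alpha> - \<xi>\<bar> \<le> 1 / (2 * K\<^sup>2)" .
  also have "\<dots> \<le> 1 / (2 * 1)" using one_le_power[OF K, of 2] by (intro divide_left_mono) auto
  finally have "\<bar>\<xi>\<bar> \<le> X" using \<alpha>(3) by linarith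
  have \<alpha>X: "\<bar>\<alpha>\<bar> \<le> X" "1 \<le> X" using \<alpha>(3) by auto
  have \<psi>0: "poly \<psi> \<alpha> = 0" using \<alpha>(1) by (simp add: \<psi>_def)
  have \<psi>\<xi>: "poly \<psi> \<xi> = \<beta> * ipoly Q \<xi> - ipoly P \<xi>" by (simp add: \<psi>_def)
  show ?thesis
  proof (cases "ipoly P \<xi> * of_int y\<^sub>2 = of_int x\<^sub>2 * ipoly Q \<xi>")
    case False
    have "k > inverse (2 * K * C\<^sub>0) * h powr (\<mu> - real d / 2)"
      unfolding h_def k_def
    proof (rule gap_or_vanishing[of P e Q K \<xi> \<beta> \<alpha>])
      have "\<bar>poly \<psi> \<xi>\<bar> \<le> K * \<bar>\<alpha> - \<xi>\<bar>"
        using poly_difference_bound[OF \<psi>0 bd(5) \<alpha>X(1) \<open>\<bar>\<xi>\<bar> \<le> X\<close>] .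
      then show "\<bar>ipoly P \<xi> - \<beta> * ipoly Q \<xi>\<bar> \<le> K * \<bar>\<alpha> - \<xi>\<bar>"
        unfolding \<psi>\<xi> by (simp add: abs_minus_commute)
    qed (use deg K bd(1)[OF \<open>\<bar>\<xi>\<bar> \<le> X\<close>] x H(1) \<mu> e appr False in \<open>auto simp: \<xi>_def\<close>)
    moreover have "inverse (S * C\<^sub>0) * h powr (\<mu> - real d / 2) \<le> inverse (2 * K * C\<^sub>0) * h powr (\<mu> - real d / 2)"
      using S2 \<mu> K by (intro mult_right_mono le_imp_inverse_le) auto
    ultimately show ?thesis by (simp add: h_def k_def)
  next
    case True
    have "e = 1"
    proof (rule ccontr)
      assume "e \<noteq> 1"
      then have e2: "2 \<le> e" using e by simp
      have "h ^ e \<le> 2 * K ^ (e + 3) * k" unfolding h_def k_def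
        using \<open>\<bar>\<xi>\<bar> \<le> X\<close> by (intro height_rational_function_value[OF deg(1,2,4-7) r eq x \<xi>_def _ \<alpha>X(2) \<alpha>(4) bd(2,3) True])
      \<comment> \<open>Enlarging \<open>e + 3\<close> to \<open>d + 3\<close> makes
        \<open>M\<close> independent of \<open>e\<close>.\<close>
      also have "\<dots> \<le> M * k"
        unfolding M_def using K h e by (intro mult_right_mono mult_left_mono power_increasing) auto
      finally have "h ^ 2 \<le> M * k" using power_increasing[OF e2, of h] h by linarith
      then have hk: "h\<^sup>2 / M \<le> k" using M by (simp add: divide_le_eq mult.commute)
      have "h powr (2 * \<mu>) / M powr \<mu> = (h\<^sup>2 / M) powr \<mu>"
        using h M by (simp add: powr_divide powr_powr flip: powr_numeral)
      also have "\<dots> \<le> k powr \<mu>" using hk \<mu> M by (intro powr_mono2) auto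
      finally have "h powr (2 * \<mu>) / M powr \<mu> \<le> k powr \<mu>" .
      \<comment> \<open>Likewise \<open>M powr \<mu>\<close> is enlarged to \<open>M ^ d\<close>, so
        that \<open>S\<close> need not depend on \<open>\<mu>\<close>.\<close>
      moreover have "h powr (2 * \<mu>) / M powr d \<le> h powr (2 * \<mu>) / M powr \<mu>"
        using M \<mu> by (intro divide_left_mono powr_mono) auto
      ultimately have kM: "h powr (2 * \<mu>) / M ^ d \<le> k powr \<mu>" using M by (simp add: powr_realpow)
      have "\<bar>\<beta> - \<eta>\<bar> < C\<^sub>0 / k powr \<mu>" using appr(2) by (simp add: \<eta>_def k_def)
      also have "\<dots> \<le> C\<^sub>0 / (h powr (2 * \<mu>) / M ^ d)"
        using kM \<mu> h M by (intro divide_left_mono) auto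
      finally have close: "\<bar>\<beta> - \<eta>\<bar> < C\<^sub>0 * M ^ d / h powr (2 * \<mu>)" by simp
      have "poly \<psi> \<xi> = ipoly Q \<xi> * (\<beta> - \<eta>)"
        using True x by (simp add: \<psi>\<xi> \<eta>_def field_simps)
      then have "\<bar>poly \<psi> \<xi>\<bar> \<le> K * \<bar>\<beta> - \<eta>\<bar>"
        using bd(1)[OF \<open>\<bar>\<xi>\<bar> \<le> X\<close>] by (simp add: abs_mult mult_right_mono)
      also have "\<dots> < K * (C\<^sub>0 * M ^ d / h powr (2 * \<mu>))" using close K by (intro mult_strict_left_mono) auto
      finally have \<psi>small: "\<bar>poly \<psi> \<xi>\<bar> < K * (C\<^sub>0 * M ^ d / h powr (2 * \<mu>))" .
      have "\<bar>\<alpha> - \<xi>\<bar> \<le> 2 * K * \<bar>poly \<psi> \<xi>\<bar>"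
        by (rule distance_le_poly_value[OF \<psi>0 \<psi> K bd(6) \<alpha>X(1) \<open>\<bar>\<xi>\<bar> \<le> X\<close> near2])
      also have "\<dots> < 2 * K * (K * (C\<^sub>0 * M ^ d / h powr (2 * \<mu>)))"
        using \<psi>small K by (intro mult_strict_left_mono) auto
      finally have upper: "\<bar>\<alpha> - \<xi>\<bar> < 2 * K * (K * (C\<^sub>0 * M ^ d / h powr (2 * \<mu>)))" .
      have "\<bar>ipoly F \<xi>\<bar> \<le> K * \<bar>\<alpha> - \<xi>\<bar>"
        using bd(4) by (intro poly_difference_bound[OF \<alpha>(2) _ \<alpha>X(1) \<open>\<bar>\<xi>\<bar> \<le> X\<close>]) (simp add: of_int_poly_pderiv)
      then have "1 \<le> h ^ d * (K * \<bar>\<alpha> - \<xi>\<bar>)"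
        unfolding h_def \<xi>_def using deg(3) x(2) F by (intro liouville) auto
      also have "\<dots> < h ^ d * (K * (2 * K * (K * (C\<^sub>0 * M ^ d / h powr (2 * \<mu>)))))"
        using upper K h by (intro mult_strict_left_mono) auto
      also have "\<dots> = (2 * K ^ 3 * M ^ d * C\<^sub>0) / (h powr (2 * \<mu>) / h ^ d)"
        by (simp add: power3_eq_cube mult_ac)
      also have "h powr (2 * \<mu>) / h ^ d = h powr (2 * \<mu> - d)" using h by (simp add: powr_diff powr_realpow)
      finally have "h powr (2 * \<mu> - d) < 2 * K ^ 3 * M ^ d * C\<^sub>0"
        using h by (subst (asm) pos_less_divide_eq) simp_all
      also have "\<dots> \<le> S * C\<^sub>0" using S \<mu> by (simp add: M_def mult_right_mono)
      also have "\<dots> \<le> h" using H(2) by (simp add: h_def)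
      \<comment> \<open>Here \<open>2 * \<mu> - d\<close> exceeds 2, hence 1, and the chain ends
        where it began although it contains a strict inequality.\<close>
      also have "h = h powr 1" using h by simp
      also have "\<dots> \<le> h powr (2 * \<mu> - d)" using h \<mu> by (intro powr_mono) auto
      finally show False by simp
    qed
    then show ?thesis using True by (simp add: \<xi>_def)
  qed
qed

section \<open>Explicit bounds\<close>

text \<open>Only indices up to \<open>n\<close> contribute to the convolution, so the bound is
  uniform in \<open>k\<close>.\<close>

lemma abs_coeff_mult_le:
  fixes A B :: "int poly"
  assumes "degree A \<le> n" "\<And>i. \<bar>coeff A i\<bar> \<le> a" "\<And>i. \<bar>coeff B i\<bar> \<le> b"
  shows "\<bar>coeff (A * B) k\<bar> \<le> int (n + 1) * (a * b)"
proof -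
  have pos: "0 \<le> a" "0 \<le> b" using assms(2)[of 0] assms(3)[of 0] by linarith+
  have "\<bar>coeff (A * B) k\<bar> \<le> (\<Sum>i\<le>k. \<bar>coeff A i * coeff B (k - i)\<bar>)"
    unfolding coeff_mult by (rule sum_abs)
  also have "\<dots> = (\<Sum>i\<in>{..k} \<inter> {..n}. \<bar>coeff A i * coeff B (k - i)\<bar>)"
    using assms(1) by (intro sum.mono_neutral_right) (auto simp: coeff_eq_0)
  also have "\<dots> \<le> (\<Sum>i\<in>{..k} \<inter> {..n}. a * b)"
    unfolding abs_mult using assms pos by (intro sum_mono mult_mono) auto
  also have "\<dots> \<le> int (n + 1) * (a * b)"
  proof -
    have "card ({..k} \<inter> {..n}) \<le> card {..n}" by (intro card_mono) auto
    then show ?thesis using pos by (simp add: mult_right_mono)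
  qed
  finally show ?thesis .
qed

lemma abs_poly_le:
  fixes f :: "real poly"
  assumes "degree f \<le> n" "\<And>i. \<bar>coeff f i\<bar> \<le> a" "\<bar>t\<bar> \<le> X" "1 \<le> X"
  shows "\<bar>poly f t\<bar> \<le> real (n + 1) * a * X ^ n"
proof -
  have a: "0 \<le> a" using assms(2)[of 0] by linarith
  have "poly f t = (\<Sum>i\<le>n. coeff f i * t ^ i)"
    unfolding poly_altdef using assms(1) by (intro sum.mono_neutral_left) (auto simp: coeff_eq_0)
  then have "\<bar>poly f t\<bar> \<le> (\<Sum>i\<le>n. \<bar>coeff f i * t ^ i\<bar>)" by (simp add: sum_abs)
  also have "\<dots> \<le> (\<Sum>i\<le>n. a * X ^ n)"
  proof (rule sum_mono)
    fix i assume "i \<in> {..n}"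
    then have "\<bar>t\<bar> ^ i \<le> X ^ n"
      using assms(3,4) power_mono[of "\<bar>t\<bar>" X i] power_increasing[of i n X] by simp
    then show "\<bar>coeff f i * t ^ i\<bar> \<le> a * X ^ n"
      using assms(2) a by (simp add: abs_mult power_abs mult_mono)
  qed
  finally show ?thesis by (simp add: mult.assoc)
qed

lemma abs_coeff_pderiv_le:
  fixes f :: "'a :: linordered_idom poly"
  assumes "degree f \<le> n" "\<And>i. \<bar>coeff f i\<bar> \<le> a"
  shows "\<bar>coeff (pderiv f) i\<bar> \<le> of_nat n * a"
proof (cases "Suc i \<le> n")
  case True
  have "\<bar>coeff (pderiv f) i\<bar> = of_nat (Suc i) * \<bar>coeff f (Suc i)\<bar>"
    unfolding coeff_pderiv abs_mult by (simp del: of_nat_Suc)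
  also have "\<dots> \<le> of_nat n * a"
    using True assms(2) by (intro mult_mono) (simp_all del: of_nat_Suc)
  finally show ?thesis .
next
  case False
  then have "coeff f (Suc i) = 0" using assms(1) by (intro coeff_eq_0) simp
  then show ?thesis using assms(2)[of 0] by (simp add: coeff_pderiv)
qed

lemma abs_poly_pderiv_le:
  fixes f :: "real poly"
  assumes "degree f \<le> n" "\<And>i. \<bar>coeff f i\<bar> \<le> a" "\<bar>t\<bar> \<le> X" "1 \<le> X"
  shows "\<bar>poly (pderiv f) t\<bar> \<le> real (n + 1) * (real n * a) * X ^ n"
    and "\<bar>poly (pderiv (pderiv f)) t\<bar> \<le> real (n + 1) * (real n * (real n * a)) * X ^ n"
proof -
  have d: "degree (pderiv f) \<le> n" "degree (pderiv (pderiv f)) \<le> n"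
    using assms(1) by (auto simp: degree_pderiv)
  have c: "\<bar>coeff (pderiv f) i\<bar> \<le> real n * a" for i
    by (rule abs_coeff_pderiv_le[OF assms(1,2)])
  show "\<bar>poly (pderiv f) t\<bar> \<le> real (n + 1) * (real n * a) * X ^ n"
    by (rule abs_poly_le[OF d(1) c assms(3,4)])
  show "\<bar>poly (pderiv (pderiv f)) t\<bar> \<le> real (n + 1) * (real n * (real n * a)) * X ^ n"
    by (rule abs_poly_le[OF d(2) abs_coeff_pderiv_le[OF d(1) c] assms(3,4)])
qed

text \<open>Cauchy's argument: if \<open>\<bar>\<alpha>\<bar> > 1\<close>, the leading term is
  balanced by lower terms, each at most \<open>a\<close> times \<open>\<bar>\<alpha>\<bar>\<close>
  to the power \<open>degree f - 1\<close>.\<close>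

lemma monic_root_bound:
  fixes f :: "real poly"
  assumes "lead_coeff f = 1" "poly f \<alpha> = 0" "\<And>i. \<bar>coeff f i\<bar> \<le> a"
  shows "\<bar>\<alpha>\<bar> \<le> max 1 (real (degree f) * a)"
proof (cases "\<bar>\<alpha>\<bar> \<le> 1")
  case False
  define d where "d = degree f"
  have "d \<noteq> 0"
  proof
    assume "d = 0"
    then obtain c where "f = [:c:]" unfolding d_def by (elim degree_eq_zeroE)
    then show False using assms by simp
  qed
  have "(\<Sum>i\<le>d. coeff f i * \<alpha> ^ i) = 0" using assms(2) by (simp add: poly_altdef d_def)
  then have "\<alpha> ^ d = - (\<Sum>i<d. coeff f i * \<alpha> ^ i)"
    using assms(1) by (simp add: d_def flip: lessThan_Suc_atMost)
  then have "\<bar>\<alpha>\<bar> ^ d = \<bar>\<Sum>i<d. coeff f i * \<alpha> ^ i\<bar>" by (metis abs_minus_cancel power_abs)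
  also have "\<dots> \<le> (\<Sum>i<d. \<bar>coeff f i * \<alpha> ^ i\<bar>)" by (rule sum_abs)
  also have "\<dots> \<le> (\<Sum>i<d. a * \<bar>\<alpha>\<bar> ^ (d - 1))"
  proof (rule sum_mono)
    fix i assume "i \<in> {..<d}"
    then have "\<bar>\<alpha>\<bar> ^ i \<le> \<bar>\<alpha>\<bar> ^ (d - 1)" using False by (intro power_increasing) auto
    then show "\<bar>coeff f i * \<alpha> ^ i\<bar> \<le> a * \<bar>\<alpha>\<bar> ^ (d - 1)"
      unfolding abs_mult power_abs using assms(3)[of i] abs_ge_zero[of "coeff f i"]
      by (intro mult_mono) (auto intro: order_trans)
  qed
  also have "\<dots> = (real d * a) * \<bar>\<alpha>\<bar> ^ (d - 1)" by simp
  also have "\<bar>\<alpha>\<bar> ^ d = \<bar>\<alpha>\<bar> * \<bar>\<alpha>\<bar> ^ (d - 1)" using \<open>d \<noteq> 0\<close> by (simp flip: power_Suc)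
  finally have "\<bar>\<alpha>\<bar> \<le> real d * a" using False by (subst (asm) mult_le_cancel_right) auto
  then show ?thesis by (simp add: d_def)
qed simp

section \<open>Relations of least degree between the two numbers\<close>

lemma ipoly_nonzero_below_degree:
  assumes "algebraic \<alpha>" "F \<noteq> 0" "degree F < degree (min_poly \<alpha>)"
  shows "ipoly F \<alpha> \<noteq> 0"
  using rpoly_nonzero_below_degree[OF assms(1), of "map_poly of_int F"] assms(2,3)
  by (simp add: rpoly_of_int_poly map_poly_eq_0_iff degree_map_poly)

lemma relation_imp_vanishing:
  fixes U\<^sub>0 U\<^sub>1 U\<^sub>2 p q :: "int poly"
  assumes "ipoly p \<alpha> = 0" "ipoly q \<alpha> = of_int c * \<beta>" "c \<noteq> 0"
    and "U\<^sub>0 * [:c:] + U\<^sub>1 * (- q) + U\<^sub>2 * (- p) = 0"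
  shows "ipoly U\<^sub>0 \<alpha> = \<beta> * ipoly U\<^sub>1 \<alpha>"
proof -
  have "U\<^sub>0 * [:c:] - U\<^sub>1 * q - U\<^sub>2 * p = 0" using assms(4) by simp
  from arg_cong[OF this, of "\<lambda>F. ipoly F \<alpha>"]
  have "of_int c * (ipoly U\<^sub>0 \<alpha> - \<beta> * ipoly U\<^sub>1 \<alpha>) = 0"
    unfolding of_int_poly_hom using assms(1,2) by (simp add: map_poly_pCons algebra_simps)
  then show ?thesis using assms(3) by simp
qed

text \<open>The polynomial \<open>P - coordinate_poly \<alpha> \<beta> * Q\<close> is divisible by
  the minimal polynomial, comparison of degrees puts the cofactor below degree \<open>m\<close>, and
  \<open>b\<close> clears its denominators. With the preceding lemma, this translates vanishing at
  \<open>\<alpha>\<close> into a linear system over the integers and back.\<close>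

lemma vanishing_imp_relation:
  fixes P Q p q :: "int poly"
  assumes \<alpha>: "algebraic \<alpha>" "\<beta> \<in> rat_adjoin \<alpha>"
    and p: "map_poly of_int p = smult (of_int c) (min_poly \<alpha>)"
    and q: "map_poly of_int q = smult (of_int c) (coordinate_poly \<alpha> \<beta>)"
    and PQ: "degree P < m" "degree Q < m" "ipoly P \<alpha> = \<beta> * ipoly Q \<alpha>"
  shows "\<exists>b W. b \<noteq> 0 \<and> (\<forall>i\<ge>m. coeff W i = 0) \<and>
    smult b P * [:c:] + smult b Q * (- q) + W * (- p) = 0"
proof -
  let ?p = "min_poly \<alpha>" and ?q = "coordinate_poly \<alpha> \<beta>"
  let ?P = "map_poly of_int P :: rat poly" and ?Q = "map_poly of_int Q :: rat poly"
  have p0: "?p \<noteq> 0" using min_poly(1)[OF \<alpha>(1)] by auto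
  define f where "f = ?P - ?q * ?Q"
  have "rpoly f \<alpha> = 0"
    using rpoly_add[of ?P "- (?q * ?Q)" \<alpha>] PQ(3) coordinate_poly(2)[OF \<alpha>]
    by (simp add: f_def rpoly_minus rpoly_mult rpoly_of_int_poly)
  then have "?p dvd f" by (rule min_poly(4)[OF \<alpha>(1)])
  then obtain w where w: "f = ?p * w" by (elim dvdE)
  have wdeg: "degree w < m"
  proof (cases "w = 0")
    case False
    have "degree ?p + degree w = degree f" using w p0 False by (simp add: degree_mult_eq)
    also have "\<dots> \<le> max (degree P) (degree ?q + degree Q)"
      unfolding f_def by (intro degree_diff_le)
        (auto simp: degree_map_poly intro: order_trans[OF degree_mult_le] le_max_iff_disj[THEN iffD2])
    also have "\<dots> < degree ?p + m" using PQ(1,2) coordinate_poly(1)[OF \<alpha>] by simp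
    finally show ?thesis by simp
  qed (use PQ in simp)
  obtain N W where W: "map_poly of_int W = smult (fact N) w" using ex_clear_denominators by blast
  have "coeff W i = 0" if "i \<ge> m" for i
  proof -
    have "of_int (coeff W i) = coeff (smult (fact N) w) i" unfolding W[symmetric] by (simp add: coeff_map_poly)
    also have "\<dots> = 0" using that wdeg by (simp add: coeff_eq_0)
    finally show ?thesis by simp
  qed
  moreover have "smult (fact N) P * [:c:] - smult (fact N) Q * q - W * p = 0"
  proof -
    have "map_poly of_int (smult (fact N) P * [:c:] - smult (fact N) Q * q - W * p) =
        smult (fact N * of_int c) (?P - ?q * ?Q - ?p * w)"
      unfolding of_int_poly_hom p q W by (simp add: map_poly_pCons smult_diff_right mult.commute)
    also have "\<dots> = 0" using w by (simp add: f_def)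
    finally show ?thesis by (simp add: map_poly_eq_0_iff)
  qed
  ultimately show ?thesis by (intro exI[of _ "fact N"] exI[of _ W]) simp
qed

lemma constant_relation_imp_rational:
  assumes "degree P = 0" "degree Q = 0" "ipoly P \<alpha> = \<beta> * ipoly Q \<alpha>" "ipoly Q \<alpha> \<noteq> 0"
  shows "\<beta> \<in> \<rat>"
proof -
  obtain a b where "P = [:a:]" "Q = [:b:]" using assms(1,2) by (elim degree_eq_zeroE)
  then have "b \<noteq> 0" "of_int a = \<beta> * of_int b" using assms(3,4) by (auto simp: map_poly_pCons)
  then have "\<beta> = of_int a / of_int b" by simp
  then show ?thesis by simp
qed

text \<open>The least degree \<open>e\<close> is found first; a solution of the corresponding system
  then exists by the choice of \<open>e\<close>, so a bounded one exists with the same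
  \<open>e\<close>. Minimality turns into the absence of relations of lower degree.\<close>

lemma minimal_relation:
  fixes p q :: "int poly"
  assumes \<alpha>: "algebraic \<alpha>" "\<beta> \<in> rat_adjoin \<alpha>" "\<beta> \<notin> \<rat>" "2 \<le> degree (min_poly \<alpha>)"
    and p: "map_poly of_int p = smult (of_int c) (min_poly \<alpha>)"
    and q: "map_poly of_int q = smult (of_int c) (coordinate_poly \<alpha> \<beta>)"
    and T: "\<And>i. \<bar>coeff p i\<bar> \<le> int T" "\<And>i. \<bar>coeff q i\<bar> \<le> int T" "0 < c" "c \<le> int T"
      "degree (min_poly \<alpha>) \<le> T"
  shows "\<exists>P Q e. 1 \<le> e \<and> 2 * e \<le> degree (min_poly \<alpha>) \<and> degree P \<le> e \<and> degree Q \<le> e \<and>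
    (\<forall>i. \<bar>coeff P i\<bar> \<le> int (relation_bound T)) \<and> (\<forall>i. \<bar>coeff Q i\<bar> \<le> int (relation_bound T)) \<and>
    ipoly P \<alpha> = \<beta> * ipoly Q \<alpha> \<and> ipoly Q \<alpha> \<noteq> 0 \<and>
    no_relation_below e P Q"
proof -
  let ?d = "degree (min_poly \<alpha>)"
  define R where "R e \<longleftrightarrow> (\<exists>P Q. (P \<noteq> 0 \<or> Q \<noteq> 0) \<and> degree P \<le> e \<and> degree Q \<le> e \<and>
      ipoly P \<alpha> = \<beta> * ipoly Q \<alpha>)" for e
  define A :: "nat \<Rightarrow> int poly" where "A = (\<lambda>j. [[:c:], - q, - p] ! j)"
  have J: "{..<3} = {0, 1, 2::nat}" by auto
  have sumA: "(\<Sum>j<3. U j * A j) = U 0 * [:c:] + U 1 * (- q) + U 2 * (- p)" for U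
    unfolding J by (simp add: A_def)
  have p0: "p \<noteq> 0" using p min_poly(1)[OF \<alpha>(1)] T(3) by auto
  have ip: "ipoly p \<alpha> = 0" "ipoly q \<alpha> = of_int c * \<beta>"
    using min_poly(3)[OF \<alpha>(1)] coordinate_poly(2)[OF \<alpha>(1,2)]
    by (simp_all flip: rpoly_of_int_poly add: p q rpoly_smult)
  have dp: "degree p \<le> ?d" "degree q < ?d"
    using arg_cong[OF p, of degree] arg_cong[OF q, of degree] coordinate_poly(1)[OF \<alpha>(1,2)] T(3)
    by (simp_all add: degree_map_poly)
  have nontriv: "(U 0 \<noteq> 0 \<or> U 1 \<noteq> 0) \<and> ipoly (U 0) \<alpha> = \<beta> * ipoly (U 1) \<alpha>"
    if "\<exists>j\<in>{..<3}. U j \<noteq> 0" "(\<Sum>j<3. U j * A j) = 0" for U :: "nat \<Rightarrow> int poly"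
  proof
    have rel: "U 0 * [:c:] + U 1 * (- q) + U 2 * (- p) = 0" using that(2) sumA by simp
    show "ipoly (U 0) \<alpha> = \<beta> * ipoly (U 1) \<alpha>"
      using relation_imp_vanishing[OF ip _ rel] T(3) by simp
    \<comment> \<open>If both vanished, \<open>U 2 * p = 0\<close> would make \<open>U 2\<close>
      vanish as well.\<close>
    show "U 0 \<noteq> 0 \<or> U 1 \<noteq> 0" using that(1) rel p0 unfolding J by auto
  qed
  define D where "D = ?d div 2"
  have D: "R D"
  proof -
    \<comment> \<open>There are \<open>3 * D + 2\<close> unknowns and \<open>?d + D\<close>
      equations, and \<open>2 * D + 2\<close> exceeds \<open>?d\<close>.\<close>
    define m :: "nat \<Rightarrow> nat" where "m = (\<lambda>j. [D + 1, D + 1, D] ! j)"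
    have "?d < 2 * D + 2" by (simp add: D_def)
    then have "?d + D < (\<Sum>j<3. m j)" by (simp add: J m_def)
    moreover have "m j + degree (A j) \<le> ?d + D" if "j \<in> {..<3}" for j
      using that dp \<alpha>(4) unfolding J by (auto simp: m_def A_def)
    ultimately obtain U where U: "\<exists>j\<in>{..<3}. U j \<noteq> 0" "\<forall>j\<in>{..<3}. \<forall>i\<ge>m j. coeff (U j) i = 0"
        "(\<Sum>j<3. U j * A j) = 0"
      using poly_relation_nontrivial[of "{..<3}" "?d + D" m A] by auto
    have "degree (U 0) \<le> D" "degree (U 1) \<le> D"
      using U(2) unfolding J by (auto simp: m_def intro!: degree_le)
    then show ?thesis using nontriv[OF U(1,3)] unfolding R_def by blast
  qed
  define e where "e = (LEAST e. R e)"
  have Re: "R e" unfolding e_def using D by (rule LeastI)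
  have eD: "e \<le> D" unfolding e_def using D by (rule Least_le)
  have min: "\<not> R k" if "k < e" for k using that not_less_Least unfolding e_def by blast
  obtain P0 Q0 where PQ0: "P0 \<noteq> 0 \<or> Q0 \<noteq> 0" "degree P0 < e + 1" "degree Q0 < e + 1"
      "ipoly P0 \<alpha> = \<beta> * ipoly Q0 \<alpha>"
    using Re unfolding R_def by (auto simp: less_Suc_eq_le)
  obtain b W where bW: "b \<noteq> 0" "\<forall>i\<ge>e + 1. coeff W i = 0"
      "smult b P0 * [:c:] + smult b Q0 * (- q) + W * (- p) = 0"
    using vanishing_imp_relation[OF \<alpha>(1,2) p q PQ0(2-4)] by blast
  define U where "U = (\<lambda>j. [smult b P0, smult b Q0, W] ! j)"
  have U: "\<exists>j\<in>{..<3}. U j \<noteq> 0" "(\<Sum>j<3. U j * A j) = 0"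
    using bW PQ0(1) unfolding sumA by (auto simp: U_def J)
  have U2: "coeff (U j) i = 0" if "j \<in> {..<3}" "e + 1 \<le> i" for i j
    using that bW(2) PQ0(2,3) unfolding J by (auto simp: U_def coeff_eq_0)
  have "e + 1 \<le> T" using eD T(5) \<alpha>(4) by (simp add: D_def)
  then have n3: "(\<Sum>j<3::nat. e + 1) \<le> 3 * T" by simp
  have AB: "\<bar>coeff (A j) i\<bar> \<le> int T" if "j \<in> {..<3}" for j i
    using that T unfolding J by (auto simp: A_def coeff_pCons split: nat.splits)
  have "1 \<le> T" using T(3,4) by linarith
  obtain V where V: "\<exists>j\<in>{..<3}. V j \<noteq> 0" "\<forall>j\<in>{..<3}. \<forall>i\<ge>e + 1. coeff (V j) i = 0"
      "(\<Sum>j<3. V j * A j) = 0"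
      "\<forall>j\<in>{..<3}. \<forall>i. \<bar>coeff (V j) i\<bar> \<le> int ((2 * (3 * T) * T) ^ (3 ^ (3 * T)))"
    using poly_relation_bounded[OF _ AB \<open>1 \<le> T\<close> U(1) U2 U(2) n3] by auto
  define P Q where "P = V 0" and "Q = V 1"
  have PQ: "P \<noteq> 0 \<or> Q \<noteq> 0" "ipoly P \<alpha> = \<beta> * ipoly Q \<alpha>"
    using nontriv[OF V(1,3)] by (auto simp: P_def Q_def)
  have deg: "degree P \<le> e" "degree Q \<le> e"
    using V(2) unfolding J by (auto simp: P_def Q_def intro!: degree_le)
  have bd: "\<bar>coeff P i\<bar> \<le> int (relation_bound T)" "\<bar>coeff Q i\<bar> \<le> int (relation_bound T)" for i
    using V(4) unfolding J by (auto simp: P_def Q_def relation_bound_def)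
  have ed: "2 * e \<le> ?d" using eD by (simp add: D_def)
  then have small: "ipoly F \<alpha> \<noteq> 0" if "F \<noteq> 0" "degree F \<le> e" for F
    using that \<alpha>(4) by (intro ipoly_nonzero_below_degree[OF \<alpha>(1)]) auto
  have Q\<alpha>: "ipoly Q \<alpha> \<noteq> 0" using PQ small deg by fastforce
  have "1 \<le> e"
  proof (rule ccontr)
    assume "\<not> 1 \<le> e"
    then have "degree P = 0" "degree Q = 0" using deg by auto
    then show False using constant_relation_imp_rational PQ(2) Q\<alpha> \<alpha>(3) by blast
  qed
  \<comment> \<open>At \<open>\<alpha>\<close> such a relation becomes
    \<open>V(\<alpha>) = - \<beta> U(\<alpha>)\<close> with degrees below \<open>e\<close>, against
    the choice of \<open>e\<close>.\<close>
  moreover have "U = 0 \<and> V = 0" if UV: "degree U < e" "degree V < e" "U * P + V * Q = 0" for U V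
  proof (rule ccontr)
    assume H: "\<not> (U = 0 \<and> V = 0)"
    from arg_cong[OF UV(3), of "\<lambda>F. ipoly F \<alpha>"]
    have "(ipoly V \<alpha> + \<beta> * ipoly U \<alpha>) * ipoly Q \<alpha> = 0"
      unfolding of_int_poly_hom using PQ(2) by (simp add: algebra_simps)
    then have "ipoly V \<alpha> = \<beta> * ipoly (- U) \<alpha>"
      using Q\<alpha> of_int_poly_diff[of 0 U, where 'a = real] by simp
    then have "R (e - 1)" unfolding R_def
      using H UV by (intro exI[of _ V] exI[of _ "- U"]) auto
    then show False using min[of "e - 1"] \<open>1 \<le> e\<close> by simp
  qed
  then have "no_relation_below e P Q" by (simp add: no_relation_below_def)
  ultimately show ?thesis using ed deg bd PQ(2) Q\<alpha> by blast
qed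

lemma rpoly_of_rat: "rpoly p (of_rat r) = of_rat (poly p r)"
  by (induction p) (simp_all add: of_rat_add of_rat_mult)

lemma irreducible_no_rational_root:
  assumes "irreducible p" "2 \<le> degree p"
  shows "rpoly p (of_rat r) \<noteq> 0"
proof
  assume "rpoly p (of_rat r) = 0"
  then have "[:- r, 1:] dvd p" by (simp add: rpoly_of_rat poly_eq_0_iff_dvd)
  then obtain k where k: "p = [:- r, 1:] * k" by (elim dvdE)
  have "p \<noteq> 0" using assms(2) by auto
  then have "k \<noteq> 0" using k by auto
  moreover have "\<not> [:- r, 1:] dvd 1" by (simp add: is_unit_iff_degree)
  ultimately have "degree k = 0" using irreducibleD[OF assms(1) k] by (simp add: is_unit_iff_degree)
  then show False using assms(2) \<open>k \<noteq> 0\<close> unfolding k by (subst (asm) degree_mult_eq) auto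
qed

section \<open>Constants in terms of the size of the data\<close>

lemma abs_coeff_le_encode: "\<bar>coeff p i\<bar> \<le> of_nat (encode_rat_poly p)"
proof -
  obtain a b where ab: "quotient_of (coeff p i) = (a, b)" by fastforce
  have b: "1 \<le> b" using quotient_of_denom_pos[OF ab] by simp
  have "\<bar>coeff p i\<bar> = of_int \<bar>a\<bar> / of_int b" using quotient_of_div[OF ab] b by simp
  also have "\<dots> \<le> of_int \<bar>a\<bar> / 1" using b by (intro divide_left_mono) auto
  also have "\<dots> \<le> of_int (int (encode_rat_poly p))"
    using coeff_le_encode_rat_poly(1)[OF ab] by (simp only: div_by_1 of_int_le_iff)
  finally show ?thesis by simp
qed

text \<open>A single expression dominating \<open>fact N\<close>, the coefficients after clearing
  denominators, \<open>N * N + 1\<close> and \<open>N + 3\<close>.\<close>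

definition input_bound :: "nat \<Rightarrow> nat" where
  "input_bound N = (N + 3) ^ (N + 3)"

text \<open>Three stages: the inner \<open>relation_bound\<close> is for \<open>P\<close> and
  \<open>Q\<close>, twice its fourth power for their Wronskian, and the outer
  \<open>relation_bound\<close> for the Bezout multipliers.\<close>

definition coeff_bound :: "nat \<Rightarrow> nat" where
  "coeff_bound N = relation_bound (2 * relation_bound (input_bound N) ^ 4)"

text \<open>Dominates, for \<open>\<bar>t\<bar> \<le> T\<close>, the values of a polynomial with
  degree and coefficients at most \<open>T\<close> and of its first two derivatives.\<close>

definition value_bound :: "nat \<Rightarrow> nat" where
  "value_bound T = (T + 1) ^ 3 * T * T ^ T"

text \<open>With \<open>k = 2 * value_bound (coeff_bound N) ^ 2\<close>, the estimate
  \<open>k \<le> 2 ^ k\<close> turns the constant demanded of \<open>S\<close> into a power of two;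
  this is its exponent with \<open>d\<close> enlarged to \<open>N\<close>.\<close>

definition scale_exponent :: "nat \<Rightarrow> nat" where
  "scale_exponent N = N + 1 + 2 * value_bound (coeff_bound N) ^ 2 * (3 + N * (N + 3))"

lemma total_recursive_scale_exponent: "total_recursive (\<lambda>\<phi> n. scale_exponent n)"
proof -
  have rel: "total_recursive (\<lambda>\<phi> n. relation_bound (f \<phi> n))" if "total_recursive f" for f
    unfolding relation_bound_def
    by (intro total_recursive_add total_recursive_mult total_recursive_power total_recursive_const that)
  have val: "total_recursive (\<lambda>\<phi> n. value_bound (f \<phi> n))" if "total_recursive f" for f
    unfolding value_bound_def
    by (intro total_recursive_add total_recursive_mult total_recursive_power total_recursive_const that)
  show ?thesis
    unfolding scale_exponent_def coeff_bound_def input_bound_def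
    by (intro total_recursive_add total_recursive_mult total_recursive_power total_recursive_const
        total_recursive_id rel val)
qed

lemma le_relation_bound:
  assumes "1 \<le> T"
  shows "T \<le> relation_bound T"
proof -
  have "T \<le> 6 * T * T" using assms by simp
  also have "\<dots> \<le> (6 * T * T) ^ (3 ^ (3 * T))" using assms by (intro self_le_power) auto
  finally show ?thesis by (simp add: relation_bound_def)
qed

lemma abs_clear_denominators_le:
  assumes "encode_rat_poly p \<le> N" "1 \<le> N"
  shows "map_poly of_int (clear_denominators N p) = smult (of_int (fact N)) p"
    and "\<bar>coeff (clear_denominators N p) i\<bar> \<le> int (input_bound N)"
proof -
  have den: "b \<le> int N" if "quotient_of (coeff p i) = (a, b)" for i a b
    using coeff_le_encode_rat_poly(2)[OF that] assms by simp
  show "map_poly of_int (clear_denominators N p) = smult (of_int (fact N)) p"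
    using of_int_clear_denominators[of p N] den by simp
  have "\<bar>of_int (coeff (clear_denominators N p) i)\<bar> = fact N * \<bar>coeff p i\<bar>"
    using coeff_clear_denominators[of p i N] den by (simp add: abs_mult)
  also have "\<dots> \<le> of_nat (N ^ N) * of_nat N"
  proof (intro mult_mono)
    show "\<bar>coeff p i\<bar> \<le> of_nat N"
      using abs_coeff_le_encode[of p i] assms(1) by (meson of_nat_le_iff order_trans)
  qed (simp_all add: fact_le_power del: of_nat_power)
  finally have "of_int \<bar>coeff (clear_denominators N p) i\<bar> \<le> (of_int (int (N ^ N * N)) :: rat)" by simp
  then have "\<bar>coeff (clear_denominators N p) i\<bar> \<le> int (N ^ N * N)" by (simp only: of_int_le_iff)
  also have "N ^ N * N = N ^ (N + 1)" by simp
  also have "\<dots> \<le> (N + 3) ^ (N + 1)" by (rule power_mono) auto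
  also have "\<dots> \<le> (N + 3) ^ (N + 3)" by (rule power_increasing) auto
  finally show "\<bar>coeff (clear_denominators N p) i\<bar> \<le> int (input_bound N)"
    by (simp add: input_bound_def)
qed

lemma fact_le_input_bound: "fact N \<le> input_bound N"
proof -
  have "fact N \<le> N ^ N" using fact_le_power[of N, where 'a = nat] by simp
  also have "\<dots> \<le> (N + 3) ^ N" by (rule power_mono) auto
  also have "\<dots> \<le> (N + 3) ^ (N + 3)" by (rule power_increasing) auto
  finally show ?thesis by (simp add: input_bound_def)
qed

lemma square_le_input_bound: "N * N + 1 \<le> input_bound N" "N + 3 \<le> input_bound N"
proof -
  have "(N + 3) ^ 2 \<le> input_bound N" "(N + 3) ^ 1 \<le> input_bound N"
    unfolding input_bound_def by (rule power_increasing; simp)+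
  then show "N * N + 1 \<le> input_bound N" "N + 3 \<le> input_bound N" by (simp_all add: power2_eq_square algebra_simps)
qed

lemma abs_ipoly_le_value_bound:
  fixes F :: "int poly"
  assumes "degree F \<le> T" "\<And>i. \<bar>coeff F i\<bar> \<le> int T" "\<bar>t\<bar> \<le> real T" "1 \<le> T"
  shows "\<bar>ipoly F t\<bar> \<le> value_bound T" "\<bar>ipoly (pderiv F) t\<bar> \<le> value_bound T"
    "\<bar>poly (pderiv (pderiv (map_poly of_int F))) t\<bar> \<le> value_bound T"
proof -
  let ?f = "map_poly real_of_int F"
  have d: "degree ?f \<le> T" using assms(1) by (simp add: degree_map_poly)
  have c: "\<bar>coeff ?f i\<bar> \<le> real T" for i
  proof -
    have "real_of_int \<bar>coeff F i\<bar> \<le> of_int (int T)" using assms(2) by (simp only: of_int_le_iff)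
    then show ?thesis by (simp add: coeff_map_poly)
  qed
  have T: "1 \<le> real T" using assms(4) by simp
  have "(T + 1) * T * T ^ T \<le> value_bound T" "(T + 1) * (T * T) * T ^ T \<le> value_bound T"
    "(T + 1) * (T * (T * T)) * T ^ T \<le> value_bound T"
  proof -
    have "(T + 1) * (1 * 1) * (T * T ^ T) \<le> (T + 1) * ((T + 1) * (T + 1)) * (T * T ^ T)"
      "(T + 1) * (T * 1) * (T * T ^ T) \<le> (T + 1) * ((T + 1) * (T + 1)) * (T * T ^ T)"
      "(T + 1) * (T * T) * (T * T ^ T) \<le> (T + 1) * ((T + 1) * (T + 1)) * (T * T ^ T)"
      by (intro mult_le_mono; simp)+
    then show "(T + 1) * T * T ^ T \<le> value_bound T" "(T + 1) * (T * T) * T ^ T \<le> value_bound T"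
      "(T + 1) * (T * (T * T)) * T ^ T \<le> value_bound T"
      unfolding value_bound_def power3_eq_cube by (simp_all only: mult_1_right mult.assoc)
  qed
  then have "real ((T + 1) * T * T ^ T) \<le> value_bound T" "real ((T + 1) * (T * T) * T ^ T) \<le> value_bound T"
    "real ((T + 1) * (T * (T * T)) * T ^ T) \<le> value_bound T" by (simp_all only: of_nat_le_iff)
  note * = this[unfolded of_nat_mult of_nat_power]
  show "\<bar>ipoly F t\<bar> \<le> value_bound T"
    by (rule order_trans[OF abs_poly_le[OF d c assms(3) T] *(1)])
  show "\<bar>ipoly (pderiv F) t\<bar> \<le> value_bound T"
    unfolding of_int_poly_pderiv by (rule order_trans[OF abs_poly_pderiv_le(1)[OF d c assms(3) T] *(2)])
  show "\<bar>poly (pderiv (pderiv ?f)) t\<bar> \<le> value_bound T"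
    by (rule order_trans[OF abs_poly_pderiv_le(2)[OF d c assms(3) T] *(3)])
qed

lemma scale_exponent_sufficient:
  assumes "d \<le> N"
  defines "K \<equiv> real (2 * value_bound (coeff_bound N) ^ 2)"
  shows "2 * K ^ 3 * (2 * K ^ (d + 3)) ^ d \<le> 2 ^ scale_exponent N"
proof -
  define k where "k = 2 * value_bound (coeff_bound N) ^ 2"
  have K: "K \<le> 2 ^ k" "0 \<le> K"
    unfolding K_def k_def[symmetric] using of_nat_less_two_power[of k, where 'a = real] by auto
  have "2 * K ^ 3 * (2 * K ^ (d + 3)) ^ d \<le> 2 * (2 ^ k) ^ 3 * (2 * (2 ^ k) ^ (d + 3)) ^ d"
    using K by (intro mult_mono power_mono) auto
  also have "\<dots> = 2 ^ (1 + k * 3 + (1 + k * (d + 3)) * d)"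
    by (simp only: power_add power_mult power_one_right)
  also have "\<dots> \<le> 2 ^ scale_exponent N"
  proof (rule power_increasing)
    have "d * (d + 3) \<le> N * (N + 3)" using assms(1) by (intro mult_le_mono) auto
    then have "k * (3 + d * (d + 3)) \<le> k * (3 + N * (N + 3))" by (intro mult_le_mono) auto
    then show "1 + k * 3 + (1 + k * (d + 3)) * d \<le> scale_exponent N"
      unfolding scale_exponent_def k_def[symmetric] using assms(1) by (simp add: algebra_simps)
  qed simp
  finally show ?thesis .
qed

text \<open>A vanishing Wronskian would itself be a relation between \<open>P\<close> and
  \<open>Q\<close>, with the derivatives as multipliers of degree below \<open>e\<close>. The degree
  bound \<open>2 * e \<le> d\<close> will then ensure that \<open>W\<close> does not vanish at
  \<open>\<alpha>\<close>.\<close>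

lemma wronskian:
  fixes P Q :: "int poly"
  assumes "1 \<le> e" "degree P \<le> e" "degree Q \<le> e" "e + 1 \<le> T"
    and bd: "\<And>i. \<bar>coeff P i\<bar> \<le> int T" "\<And>i. \<bar>coeff Q i\<bar> \<le> int T"
    and norel: "no_relation_below e P Q"
    and nonconst: "degree P \<noteq> 0 \<or> degree Q \<noteq> 0"
  defines "W \<equiv> pderiv P * Q - P * pderiv Q"
  shows "W \<noteq> 0" "degree W < 2 * e" "\<bar>coeff W i\<bar> \<le> int (2 * T ^ 4)"
proof -
  have d: "degree (pderiv P) \<le> e - 1" "degree (pderiv Q) \<le> e - 1"
    using assms(2,3) by (auto simp: degree_pderiv)
  show "W \<noteq> 0"
  proof
    assume "W = 0"
    then have "(- pderiv Q) * P + pderiv P * Q = 0" by (simp add: W_def algebra_simps)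
    then have "pderiv Q = 0" "pderiv P = 0"
      using no_relation_belowD[OF norel, of "- pderiv Q" "pderiv P"] d assms(1) by auto
    then show False using nonconst by (simp add: pderiv_eq_0_iff)
  qed
  have "degree W \<le> 2 * e - 1"
    unfolding W_def using d assms(1-3)
    by (intro degree_diff_le order_trans[OF degree_mult_le]) auto
  then show "degree W < 2 * e" using assms(1) by simp
  have c: "\<bar>coeff (pderiv P) i\<bar> \<le> int e * int T" "\<bar>coeff (pderiv Q) i\<bar> \<le> int e * int T" for i
    using abs_coeff_pderiv_le[OF assms(2) bd(1)] abs_coeff_pderiv_le[OF assms(3) bd(2)] by auto
  have "degree (pderiv P) \<le> e" using d by simp
  then have "\<bar>coeff W i\<bar> \<le> int (e + 1) * (int e * int T * int T) + int (e + 1) * (int T * (int e * int T))"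
    unfolding W_def coeff_diff
    using abs_coeff_mult_le[OF \<open>degree (pderiv P) \<le> e\<close> c(1) bd(2), of i]
      abs_coeff_mult_le[OF assms(2) bd(1) c(2), of i] by linarith
  also have "\<dots> = int (2 * ((e + 1) * (e * T * T)))" by (simp add: algebra_simps)
  also have "\<dots> \<le> int (2 * T ^ 4)"
  proof -
    have "(e + 1) * (e * T * T) \<le> T * (T * T * T)" using assms(4) by (intro mult_le_mono) auto
    then show ?thesis unfolding of_nat_le_iff by (simp add: eval_nat_numeral)
  qed
  finally show "\<bar>coeff W i\<bar> \<le> int (2 * T ^ 4)" .
qed

text \<open>Supplies the polynomials and the explicit \<open>K\<close> for
  \<open>gap_or_degree_one\<close>; in its second case \<open>P\<close> and \<open>Q\<close> are
  linear and their coefficients form the required matrix.\<close>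

lemma gap_or_linear_fractional:
  fixes \<alpha> \<beta> \<mu> C\<^sub>0 :: real
  assumes adm: "algebraic_of_degree \<alpha> d" "3 \<le> d" "\<beta> \<in> rat_adjoin \<alpha>" "\<beta> \<notin> \<rat>"
      "real d / 2 + 1 < \<mu>" "\<mu> < real d" "0 < C\<^sub>0"
  defines "S \<equiv> 2 ^ scale_exponent (data_size \<alpha> \<beta>)"
  assumes x: "coprime x\<^sub>1 y\<^sub>1" "y\<^sub>1 \<noteq> 0" "coprime x\<^sub>2 y\<^sub>2" "y\<^sub>2 \<noteq> 0"
    and H: "height x\<^sub>1 y\<^sub>1 \<le> height x\<^sub>2 y\<^sub>2" "S * C\<^sub>0 \<le> real_of_int (height x\<^sub>1 y\<^sub>1)"
    and appr: "\<bar>\<alpha> - real_of_int x\<^sub>1 / real_of_int y\<^sub>1\<bar> < C\<^sub>0 / real_of_int (height x\<^sub>1 y\<^sub>1) powr \<mu>"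
      "\<bar>\<beta> - real_of_int x\<^sub>2 / real_of_int y\<^sub>2\<bar> < C\<^sub>0 / real_of_int (height x\<^sub>2 y\<^sub>2) powr \<mu>"
  shows "real_of_int (height x\<^sub>2 y\<^sub>2) > inverse (S * C\<^sub>0) * real_of_int (height x\<^sub>1 y\<^sub>1) powr (\<mu> - real d / 2) \<or>
    (\<exists>s t u v :: int. s * v - t * u \<noteq> 0 \<and>
      real_of_int u * \<alpha> + real_of_int v \<noteq> 0 \<and> u * x\<^sub>1 + v * y\<^sub>1 \<noteq> 0 \<and>
      \<beta> = (real_of_int s * \<alpha> + real_of_int t) / (real_of_int u * \<alpha> + real_of_int v) \<and>
      real_of_int x\<^sub>2 / real_of_int y\<^sub>2 =
        real_of_int (s * x\<^sub>1 + t * y\<^sub>1) / real_of_int (u * x\<^sub>1 + v * y\<^sub>1))"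
proof -
  define N where "N = data_size \<alpha> \<beta>"
  define T\<^sub>0 T\<^sub>1 T\<^sub>2 T where "T\<^sub>0 = input_bound N" and "T\<^sub>1 = relation_bound T\<^sub>0"
    and "T\<^sub>2 = 2 * T\<^sub>1 ^ 4" and "T = relation_bound T\<^sub>2"
  have T_eq: "T = coeff_bound N" by (simp add: coeff_bound_def T_def T\<^sub>2_def T\<^sub>1_def T\<^sub>0_def)
  have alg: "algebraic \<alpha>" and d: "d = degree (min_poly \<alpha>)"
    using adm(1) by (auto simp: algebraic_of_degree_def)
  note p = min_poly[OF alg] and q = coordinate_poly[OF alg adm(3)]
  have enc: "encode_rat_poly (min_poly \<alpha>) \<le> N" "encode_rat_poly (coordinate_poly \<alpha> \<beta>) \<le> N"
    by (simp_all add: N_def data_size_def)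
  have dN: "d \<le> N" using degree_le_encode_rat_poly[of "min_poly \<alpha>"] enc d by simp
  then have N: "1 \<le> N" "3 \<le> N" using adm(2) by auto
  have T0: "N + 3 \<le> T\<^sub>0" "N * N + 1 \<le> T\<^sub>0" using square_le_input_bound by (auto simp: T\<^sub>0_def)
  have T1: "T\<^sub>0 \<le> T\<^sub>1" unfolding T\<^sub>1_def using T0 by (intro le_relation_bound) auto
  have "T\<^sub>1 \<le> T\<^sub>1 ^ 4" using T1 T0 by (intro self_le_power) auto
  then have T2: "T\<^sub>1 \<le> T\<^sub>2" by (simp add: T\<^sub>2_def)
  have T3: "T\<^sub>2 \<le> T" unfolding T_def using T0 T1 T2 by (intro le_relation_bound) auto
  have TT: "N + 3 \<le> T" "N * N + 1 \<le> T" "1 \<le> T" using T0 T1 T2 T3 by auto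
  define F where "F = clear_denominators N (min_poly \<alpha>)"
  have F: "map_poly of_int F = smult (of_int (fact N)) (min_poly \<alpha>)" "\<bar>coeff F i\<bar> \<le> int T\<^sub>0" for i
    using abs_clear_denominators_le[OF enc(1) N(1)] by (auto simp: F_def T\<^sub>0_def)
  have dF: "degree F \<le> d" unfolding F_def d by (rule degree_clear_denominators)
  have "int (fact N) \<le> int T\<^sub>0" using fact_le_input_bound[of N] by (simp only: of_nat_le_iff T\<^sub>0_def)
  then have factN: "0 < (fact N :: int)" "(fact N :: int) \<le> int T\<^sub>0"
    by (simp_all only: of_nat_fact fact_gt_zero)
  have ipF: "ipoly F t = fact N * rpoly (min_poly \<alpha>) t" for t
    by (simp only: rpoly_of_int_poly[symmetric] F(1) rpoly_smult of_rat_of_int_eq) simp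
  have d2: "2 \<le> degree (min_poly \<alpha>)" and dT0: "degree (min_poly \<alpha>) \<le> T\<^sub>0"
    using adm(2) d dN T0 by auto
  obtain P Q e where e: "1 \<le> e" "2 * e \<le> d" and deg: "degree P \<le> e" "degree Q \<le> e"
    and PQ: "\<And>i. \<bar>coeff P i\<bar> \<le> int T\<^sub>1" "\<And>i. \<bar>coeff Q i\<bar> \<le> int T\<^sub>1"
      "ipoly P \<alpha> = \<beta> * ipoly Q \<alpha>" "ipoly Q \<alpha> \<noteq> 0"
    and norel: "no_relation_below e P Q"
    using minimal_relation[OF alg adm(3,4) d2 F(1) abs_clear_denominators_le(1)[OF enc(2) N(1)]
        F(2) abs_clear_denominators_le(2)[OF enc(2) N(1), folded T\<^sub>0_def] factN dT0,
        folded d T\<^sub>1_def] by blast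
  have nonconst: "degree P \<noteq> 0 \<or> degree Q \<noteq> 0"
    using constant_relation_imp_rational[OF _ _ PQ(3,4)] adm(4) by blast
  have eT: "e + 1 \<le> T\<^sub>1" "e \<le> T\<^sub>2" "d \<le> T\<^sub>2" using e dN T0 T1 T2 by auto
  define W where "W = pderiv P * Q - P * pderiv Q"
  have W: "W \<noteq> 0" "degree W < 2 * e" "\<And>i. \<bar>coeff W i\<bar> \<le> int T\<^sub>2"
    using wronskian[OF e(1) deg eT(1) PQ(1,2) norel nonconst] unfolding W_def T\<^sub>2_def by auto
  have PQ2: "\<bar>coeff P i\<bar> \<le> int T\<^sub>2" "\<bar>coeff Q i\<bar> \<le> int T\<^sub>2" "\<bar>coeff F i\<bar> \<le> int T\<^sub>2" for i
    using PQ(1,2)[of i] F(2)[of i] T1 T2 by linarith+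
  have j: "0 < 2 * e" "2 * e - 1 < 2 * e" "0 < 2 * d" using e by auto
  obtain U\<^sub>1 V\<^sub>1 r\<^sub>1 where B1: "r\<^sub>1 \<noteq> 0" "\<bar>r\<^sub>1\<bar> \<le> int T" "degree U\<^sub>1 < e" "degree V\<^sub>1 < e"
      "\<And>i. \<bar>coeff U\<^sub>1 i\<bar> \<le> int T" "\<And>i. \<bar>coeff V\<^sub>1 i\<bar> \<le> int T" "U\<^sub>1 * P + V\<^sub>1 * Q = monom r\<^sub>1 0"
    using bezout_bounded[OF deg e(1) eT(2) PQ2(1,2) norel j(1), folded T_def] by blast
  obtain U\<^sub>2 V\<^sub>2 r\<^sub>2 where B2: "r\<^sub>2 \<noteq> 0" "\<bar>r\<^sub>2\<bar> \<le> int T" "degree U\<^sub>2 < e" "degree V\<^sub>2 < e"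
      "U\<^sub>2 * P + V\<^sub>2 * Q = monom r\<^sub>2 (2 * e - 1)"
    using bezout_bounded[OF deg e(1) eT(2) PQ2(1,2) norel j(2), folded T_def] by blast
  have W\<alpha>: "ipoly W \<alpha> \<noteq> 0" using W e d by (intro ipoly_nonzero_below_degree[OF alg]) auto
  have F\<alpha>: "ipoly F \<alpha> = 0" using p(3) by (simp add: ipF)
  \<comment> \<open>\<open>F\<close> vanishes at \<open>\<alpha>\<close> and \<open>W\<close> does
    not, so \<open>V\<close> vanishes there and is zero because of its degree.\<close>
  have "U = 0 \<and> V = 0" if UV: "degree U < d" "degree V < d" "U * F + V * W = 0" for U V
  proof -
    have "ipoly V \<alpha> * ipoly W \<alpha> = 0"
      using arg_cong[OF UV(3), of "\<lambda>F. ipoly F \<alpha>"] F\<alpha> unfolding of_int_poly_hom by simp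
    then have "V = 0" using ipoly_nonzero_below_degree[OF alg, of V] UV(2) W\<alpha> d by auto
    moreover have "F \<noteq> 0" using F(1) p(1) by auto
    ultimately show ?thesis using UV(3) by simp
  qed
  then have norelF: "no_relation_below d F W" by (simp add: no_relation_below_def)
  have d1: "1 \<le> d" "degree W \<le> d" using adm(2) W(2) e by auto
  \<comment> \<open>Evaluated at \<open>\<alpha>\<close>, this identity makes the nonvanishing of
    \<open>W\<close> effective, since \<open>r\<^sub>3\<close> is a nonzero integer.\<close>
  obtain U\<^sub>3 V\<^sub>3 r\<^sub>3 where B3: "r\<^sub>3 \<noteq> 0" "degree V\<^sub>3 < d" "\<And>i. \<bar>coeff V\<^sub>3 i\<bar> \<le> int T"
      "U\<^sub>3 * F + V\<^sub>3 * W = monom r\<^sub>3 0"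
    using bezout_bounded[OF dF d1(2,1) eT(3) PQ2(3) W(3) norelF j(3), folded T_def] by blast
  define G where "G = real (value_bound T)"
  \<comment> \<open>This covers \<open>G * G + G\<close>, which bounds the derivatives of
    \<open>\<psi>\<close>, and the product \<open>G * G\<close> in the lower bound for
    \<open>pderiv \<psi>\<close> at \<open>\<alpha>\<close>.\<close>
  define K where "K = 2 * G\<^sup>2"
  have "T * 1 \<le> (T + 1) ^ 3 * T * T ^ T" using TT by (simp add: Suc_le_eq)
  then have "T \<le> value_bound T" by (simp add: value_bound_def)
  then have G: "real T \<le> G" "1 \<le> G" using TT by (auto simp: G_def)
  have GG: "G \<le> G\<^sup>2" using G(2) by (simp add: self_le_power)
  then have K: "G \<le> K" "real T \<le> K" "1 \<le> K" "G * G + G \<le> K"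
    using G GG unfolding K_def power2_eq_square by linarith+
  have dT: "d \<le> T" using dN TT by simp
  have PQT: "\<bar>coeff P i\<bar> \<le> int T" "\<bar>coeff Q i\<bar> \<le> int T" "\<bar>coeff F i\<bar> \<le> int T" for i
    using PQ2[of i] T3 by linarith+
  have degT: "degree P \<le> T" "degree Q \<le> T" "degree F \<le> T" "degree U\<^sub>1 \<le> T" "degree V\<^sub>1 \<le> T" "degree V\<^sub>3 \<le> T"
    using deg dF B1 B3 e dT by auto
  note bP = abs_ipoly_le_value_bound[OF degT(1) PQT(1) _ TT(3), folded G_def]
    and bQ = abs_ipoly_le_value_bound[OF degT(2) PQT(2) _ TT(3), folded G_def]
    and bF = abs_ipoly_le_value_bound[OF degT(3) PQT(3) _ TT(3), folded G_def]
    and bU = abs_ipoly_le_value_bound[OF degT(4) B1(5) _ TT(3), folded G_def]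
    and bV = abs_ipoly_le_value_bound[OF degT(5) B1(6) _ TT(3), folded G_def]
    and bV3 = abs_ipoly_le_value_bound[OF degT(6) B3(3) _ TT(3), folded G_def]
  have coeffN: "\<bar>real_of_rat (coeff f i)\<bar> \<le> real N" if "encode_rat_poly f \<le> N" for f i
  proof -
    have "\<bar>coeff f i\<bar> \<le> of_nat N"
      using abs_coeff_le_encode[of f i] that by (meson of_nat_le_iff order_trans)
    then have "real_of_rat \<bar>coeff f i\<bar> \<le> of_rat (of_nat N)" by (simp only: of_rat_less_eq)
    then show ?thesis by simp
  qed
  have "\<bar>\<alpha>\<bar> \<le> max 1 (real (degree (map_poly real_of_rat (min_poly \<alpha>))) * real N)"
  proof (rule monic_root_bound)
    show "lead_coeff (map_poly real_of_rat (min_poly \<alpha>)) = 1"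
      using p(1) by (simp add: coeff_map_poly degree_map_poly)
    show "poly (map_poly real_of_rat (min_poly \<alpha>)) \<alpha> = 0" using p(3) by (simp add: rpoly_def)
  qed (use coeffN[OF enc(1)] in \<open>simp add: coeff_map_poly\<close>)
  also have "\<dots> \<le> real N * real N"
    using dN N d by (auto simp: degree_map_poly mult_right_mono intro: order_trans[of 1 "real N * 1"] mult_left_mono)
  finally have "\<bar>\<alpha>\<bar> + 1 \<le> real (N * N + 1)" by simp
  also have "\<dots> \<le> real T" using TT(2) by (simp only: of_nat_le_iff)
  finally have \<alpha>T: "\<bar>\<alpha>\<bar> + 1 \<le> real T" .
  then have \<alpha>T': "\<bar>\<alpha>\<bar> \<le> real T" by simp
  have "\<bar>\<beta>\<bar> \<le> G"
  proof -
    have "\<bar>rpoly (coordinate_poly \<alpha> \<beta>) \<alpha>\<bar> \<le> real (T + 1) * real T * real T ^ T"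
      unfolding rpoly_def
    proof (rule abs_poly_le[OF _ _ \<alpha>T'])
      show "degree (map_poly real_of_rat (coordinate_poly \<alpha> \<beta>)) \<le> T"
        using q(1) d dT by (simp add: degree_map_poly)
      show "\<bar>coeff (map_poly real_of_rat (coordinate_poly \<alpha> \<beta>)) i\<bar> \<le> real T" for i
        using coeffN[OF enc(2), of i] TT(1) by (simp add: coeff_map_poly)
      show "1 \<le> real T" using TT(3) by simp
    qed
    also have "\<dots> = real ((T + 1) * (T * T ^ T))" by (simp only: of_nat_mult of_nat_power mult.assoc)
    also have "(T + 1) * (T * T ^ T) \<le> (T + 1) ^ 3 * (T * T ^ T)"
      by (intro mult_le_mono self_le_power) auto
    finally show ?thesis using q(2) by (simp add: G_def value_bound_def mult.assoc)
  qed
  define \<psi> where "\<psi> = smult \<beta> (map_poly of_int Q) - map_poly of_int P"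
  have d\<psi>: "\<bar>\<beta> * b - a\<bar> \<le> K" if "\<bar>a\<bar> \<le> G" "\<bar>b\<bar> \<le> G" for a b
  proof -
    have "\<bar>\<beta> * b - a\<bar> \<le> \<bar>\<beta>\<bar> * \<bar>b\<bar> + \<bar>a\<bar>" by (metis abs_mult abs_triangle_ineq4)
    also have "\<dots> \<le> G * G + G" using that \<open>\<bar>\<beta>\<bar> \<le> G\<close> G by (intro add_mono mult_mono) auto
    finally show ?thesis using K by simp
  qed
  have \<psi>1: "\<bar>poly (pderiv \<psi>) t\<bar> \<le> K" if "\<bar>t\<bar> \<le> real T" for t
    using d\<psi>[OF bP(2) bQ(2), OF that that] by (simp add: \<psi>_def pderiv_diff pderiv_smult of_int_poly_pderiv)
  have \<psi>2: "\<bar>poly (pderiv (pderiv \<psi>)) t\<bar> \<le> K" if "\<bar>t\<bar> \<le> real T" for t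
    using d\<psi>[OF bP(3) bQ(3), OF that that] by (simp add: \<psi>_def pderiv_diff pderiv_smult)
  have \<psi>low: "1 / K \<le> \<bar>poly (pderiv \<psi>) \<alpha>\<bar>"
  proof -
    \<comment> \<open>Replacing \<open>P(\<alpha>)\<close> by \<open>\<beta> Q(\<alpha>)\<close> in
      the Wronskian leaves the derivative of \<open>\<psi>\<close> as a factor.\<close>
    have "ipoly W \<alpha> = - ipoly Q \<alpha> * poly (pderiv \<psi>) \<alpha>"
      unfolding W_def of_int_poly_hom \<psi>_def using PQ(3)
      by (simp add: pderiv_diff pderiv_smult algebra_simps)
    then have "of_int r\<^sub>3 = ipoly V\<^sub>3 \<alpha> * (- ipoly Q \<alpha> * poly (pderiv \<psi>) \<alpha>)"
      using arg_cong[OF B3(4), of "\<lambda>F. ipoly F \<alpha>"] F\<alpha>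
      by (simp add: of_int_poly_add of_int_poly_mult map_poly_monom poly_monom)
    moreover have "(1::real) \<le> \<bar>of_int r\<^sub>3\<bar>" using B3(1) by linarith
    ultimately have "1 \<le> \<bar>ipoly V\<^sub>3 \<alpha>\<bar> * (\<bar>ipoly Q \<alpha>\<bar> * \<bar>poly (pderiv \<psi>) \<alpha>\<bar>)" by (simp add: abs_mult)
    also have "\<dots> \<le> G * (G * \<bar>poly (pderiv \<psi>) \<alpha>\<bar>)"
      using bV3(1)[OF \<alpha>T'] bQ(1)[OF \<alpha>T'] G by (intro mult_mono) auto
    also have "\<dots> = (G * G) * \<bar>poly (pderiv \<psi>) \<alpha>\<bar>" by simp
    also have "\<dots> \<le> K * \<bar>poly (pderiv \<psi>) \<alpha>\<bar>" using K G by (intro mult_right_mono) auto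
    finally show ?thesis using K by (simp add: divide_le_eq mult.commute)
  qed
  have noroot: "ipoly F (of_int a / of_int b) \<noteq> 0" for a b
  proof -
    have "rpoly (min_poly \<alpha>) (of_rat (of_int a / of_int b)) \<noteq> 0"
      using irreducible_no_rational_root[OF p(2)] adm(2) d by simp
    then show ?thesis by (simp add: ipF of_rat_divide)
  qed
  have SK: "2 * K ^ 3 * (2 * K ^ (d + 3)) ^ d \<le> S"
    using scale_exponent_sufficient[OF dN] unfolding S_def N_def[symmetric] K_def G_def T_eq by simp
  have rK: "\<bar>real_of_int r\<^sub>1\<bar> \<le> K" "\<bar>real_of_int r\<^sub>2\<bar> \<le> K"
  proof -
    have "real_of_int \<bar>r\<^sub>1\<bar> \<le> of_int (int T)" "real_of_int \<bar>r\<^sub>2\<bar> \<le> of_int (int T)"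
      using B1(2) B2(2) by (simp_all only: of_int_le_iff)
    then show "\<bar>real_of_int r\<^sub>1\<bar> \<le> K" "\<bar>real_of_int r\<^sub>2\<bar> \<le> K" using K(2) by simp_all
  qed
  let ?\<xi> = "real_of_int x\<^sub>1 / of_int y\<^sub>1"
  consider "real_of_int (height x\<^sub>2 y\<^sub>2) > inverse (S * C\<^sub>0) * real_of_int (height x\<^sub>1 y\<^sub>1) powr (\<mu> - real d / 2)"
    | "e = 1" "ipoly P ?\<xi> * of_int y\<^sub>2 = of_int x\<^sub>2 * ipoly Q ?\<xi>"
    using gap_or_degree_one[OF e deg dF B1(3,4) B2(3,4) B1(1) B2(1) rK B1(7) B2(5) PQ(3) F\<alpha> \<alpha>T K(2) noroot
        order_trans[OF bQ(1) K(1)] order_trans[OF bU(1) K(1)] order_trans[OF bV(1) K(1)]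
        order_trans[OF bF(2) K(1)] \<psi>1[unfolded \<psi>_def] \<psi>2[unfolded \<psi>_def] \<psi>low[unfolded \<psi>_def]
        adm(5-7) SK x H appr] by blast
  then show ?thesis
  proof cases
    case 2
    define s t u v where "s = coeff P 1" and "t = coeff P 0" and "u = coeff Q 1" and "v = coeff Q 0"
    have P: "P = [:t, s:]" and Q: "Q = [:v, u:]"
      using deg 2(1) by (auto intro!: poly_eqI simp: s_def t_def u_def v_def coeff_pCons coeff_eq_0 split: nat.splits)
    have iP: "ipoly P z = of_int s * z + of_int t" and iQ: "ipoly Q z = of_int u * z + of_int v" for z
      unfolding P Q by (simp_all add: map_poly_pCons)
    have "s * v - t * u \<noteq> 0"
    proof
      assume "s * v - t * u = 0"
      \<comment> \<open>A zero determinant gives a relation with constant multipliers, which is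
        excluded for \<open>e = 1\<close> unless \<open>P\<close> and \<open>Q\<close> are both
        constant.\<close>
      then have "[:u:] * P + [:- s:] * Q = 0" unfolding P Q by (simp add: algebra_simps)
      then have "u = 0" "s = 0" using no_relation_belowD[OF norel, of "[:u:]" "[:- s:]"] 2(1) by auto
      then show False using nonconst unfolding P Q by simp
    qed
    \<comment> \<open>Otherwise \<open>P\<close> and \<open>Q\<close> would share the zero
      \<open>?\<xi>\<close>, against the first Bezout identity.\<close>
    moreover have "ipoly Q ?\<xi> \<noteq> 0"
    proof
      assume "ipoly Q ?\<xi> = 0"
      then have "ipoly P ?\<xi> = 0" using 2(2) x(4) by simp
      then have "of_int r\<^sub>1 = (0::real)"
        using arg_cong[OF B1(7), of "\<lambda>F. ipoly F ?\<xi>"] \<open>ipoly Q ?\<xi> = 0\<close>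
        by (simp add: of_int_poly_add of_int_poly_mult map_poly_monom poly_monom)
      then show False using B1(1) by simp
    qed
    moreover have y: "of_int (u * x\<^sub>1 + v * y\<^sub>1) = of_int y\<^sub>1 * ipoly Q ?\<xi>"
      "of_int (s * x\<^sub>1 + t * y\<^sub>1) = of_int y\<^sub>1 * ipoly P ?\<xi>"
      using x(2) by (simp_all add: iP iQ field_simps)
    ultimately have "real_of_int (u * x\<^sub>1 + v * y\<^sub>1) \<noteq> 0" using x(2) by simp
    then have "u * x\<^sub>1 + v * y\<^sub>1 \<noteq> 0" by (simp only: of_int_eq_0_iff not_False_eq_True)
    moreover have "real_of_int x\<^sub>2 / of_int y\<^sub>2 = of_int (s * x\<^sub>1 + t * y\<^sub>1) / of_int (u * x\<^sub>1 + v * y\<^sub>1)"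
      unfolding y using 2(2) x(2,4) \<open>ipoly Q ?\<xi> \<noteq> 0\<close> by (simp add: frac_eq_eq mult.commute)
    moreover have "\<beta> = (of_int s * \<alpha> + of_int t) / (of_int u * \<alpha> + of_int v)" "of_int u * \<alpha> + of_int v \<noteq> 0"
      using PQ(3,4) by (auto simp: iP iQ)
    ultimately show ?thesis using \<open>s * v - t * u \<noteq> 0\<close> by blast
  qed blast
qed

theorem theorem1p1:
  shows "\<exists>C\<^sub>1 C\<^sub>2 :: real \<Rightarrow> real \<Rightarrow> real \<Rightarrow> real \<Rightarrow> real.
    effectively_computable C\<^sub>1 \<and> effectively_computable C\<^sub>2 \<and>
    (\<forall>(d::nat) (\<alpha>::real) (\<beta>::real) (\<mu>::real) (C\<^sub>0::real).
      algebraic_of_degree \<alpha> d \<and> 3 \<le> d \<and> \<beta> \<in> rat_adjoin \<alpha> \<and> \<beta> \<notin> \<rat> \<and>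
      real d / 2 + 1 < \<mu> \<and> \<mu> < real d \<and> 0 < C\<^sub>0 \<longrightarrow>
      0 < C\<^sub>1 \<alpha> \<beta> \<mu> C\<^sub>0 \<and> 0 < C\<^sub>2 \<alpha> \<beta> \<mu> C\<^sub>0 \<and>
      (\<forall>x\<^sub>1 y\<^sub>1 x\<^sub>2 y\<^sub>2 :: int.
        coprime x\<^sub>1 y\<^sub>1 \<and> y\<^sub>1 \<noteq> 0 \<and> coprime x\<^sub>2 y\<^sub>2 \<and> y\<^sub>2 \<noteq> 0 \<and>
        height x\<^sub>1 y\<^sub>1 \<le> height x\<^sub>2 y\<^sub>2 \<and> C\<^sub>1 \<alpha> \<beta> \<mu> C\<^sub>0 \<le> real_of_int (height x\<^sub>1 y\<^sub>1) \<and>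
        \<bar>\<alpha> - real_of_int x\<^sub>1 / real_of_int y\<^sub>1\<bar> < C\<^sub>0 / real_of_int (height x\<^sub>1 y\<^sub>1) powr \<mu> \<and>
        \<bar>\<beta> - real_of_int x\<^sub>2 / real_of_int y\<^sub>2\<bar> < C\<^sub>0 / real_of_int (height x\<^sub>2 y\<^sub>2) powr \<mu> \<longrightarrow>
        real_of_int (height x\<^sub>2 y\<^sub>2) >
          inverse (C\<^sub>2 \<alpha> \<beta> \<mu> C\<^sub>0) * real_of_int (height x\<^sub>1 y\<^sub>1) powr (\<mu> - real d / 2) \<or>
        (\<exists>s t u v :: int. s * v - t * u \<noteq> 0 \<and>
          real_of_int u * \<alpha> + real_of_int v \<noteq> 0 \<and> u * x\<^sub>1 + v * y\<^sub>1 \<noteq> 0 \<and>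
          \<beta> = (real_of_int s * \<alpha> + real_of_int t) / (real_of_int u * \<alpha> + real_of_int v) \<and>
          real_of_int x\<^sub>2 / real_of_int y\<^sub>2 =
            real_of_int (s * x\<^sub>1 + t * y\<^sub>1) / real_of_int (u * x\<^sub>1 + v * y\<^sub>1))))"
proof -
  let ?C = "\<lambda>\<alpha> \<beta> (\<mu>::real) C\<^sub>0::real. 2 ^ scale_exponent (data_size \<alpha> \<beta>) * C\<^sub>0"
  have "effectively_computable ?C"
    by (rule effectively_computable_scaled[OF total_recursive_scale_exponent])
  moreover have "0 < ?C \<alpha> \<beta> \<mu> C\<^sub>0" if "0 < C\<^sub>0" for \<alpha> \<beta> \<mu> C\<^sub>0 :: real
    using that by simp
  ultimately show ?thesis
    by (intro exI[of _ ?C] conjI allI impI; (elim conjE)?) (assumption | rule gap_or_linear_fractional | blast)+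
qed

end
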